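(* (a) For each $i\ge1$ let $x_i,y_i,A_i,B_i$ be complex numbers with $A_i,B_i\neq0$, and let $\mathfrak S_{\lambda/\mu}$ be the six-vertex model of the context with row-$i$ weights $$\mathtt a_1^{(i)}=A_i,\ \mathtt a_2^{(i)}=y_iA_iB_i,\ \mathtt b_1^{(i)}=A_iB_i,\ \mathtt b_2^{(i)}=x_iA_i,\ \mathtt c_1^{(i)}=(x_i+y_i)A_iB_i,\ \mathtt c_2^{(i)}=A_i.$$ Then complex parameters $s_k^{(j)}$ ($k,j\ge1$) satisfy $$Z(\mathfrak S_{\lambda/\mu})=\prod_{i=1}^NA_i^{M+1}B_i^{\ell(\lambda)}\cdot\langle\mu|e^{H_+}|\lambda\rangle\quad\text{for all strict partitions }\lambda,\mu\text{, all }N\ge1\text{ and all }M\ge\max(\lambda_1,\mu_1)$$ if and only if $$s_k^{(j)}=\frac1k\left(x_j^k+(-1)^{k-1}y_j^k\right)\quad\text{for all }k\ge1,\ j\ge1.$$ (b) Let instead the row weights $\mathtt a_1^{(i)},\mathtt a_2^{(i)},\mathtt b_1^{(i)},\mathtt b_2^{(i)},\mathtt c_1^{(i)},\mathtt c_2^{(i)}$ ($i\ge 1$) be arbitrary nonzero complex numbers, and put $A_i=\mathtt a_1^{(i)}$, $B_i=\mathtt b_1^{(i)}/\mathtt a_1^{(i)}$. If the weights are not free fermionic, i.e. $\mathtt a_1^{(i)}\mathtt a_2^{(i)}+\mathtt b_1^{(i)}\mathtt b_2^{(i)}\ne\mathtt c_1^{(i)}\mathtt c_2^{(i)}$ for some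 $i$, then there is no choice of the parameters $s_k^{(j)}$ for which the displayed identity $Z=\prod_{i=1}^NA_i^{M+1}B_i^{\ell(\lambda)}\langle\mu|e^{H_+}|\lambda\rangle$ holds for all strict partitions $\lambda,\mu$ and all $M,N$.
   Context: A strict partition is $\lambda=(\lambda_1>\dots>\lambda_\ell\ge0)$, $\ell=\ell(\lambda)$ its length (a part $0$ is allowed and counted). Fock space. Basis: semi-infinite wedges $u_{m_1}\wedge u_{m_2}\wedge\cdots$ with integers $m_1>m_2>\cdots$ such that, for some integer $c$, $m_r=c-r$ for all large $r$; $u_a\wedge u_b=-u_b\wedge u_a$. $|\lambda\rangle=u_{\lambda_1}\wedge\dots\wedge u_{\lambda_\ell}\wedge u_{-1}\wedge u_{-2}\wedge\cdots$; $\langle\mu|X|\lambda\rangle$ is the coefficient of $|\mu\rangle$ in $X|\lambda\rangle$. $J_k(u_{m_1}\wedge u_{m_2}\wedge\cdots)=\sum_{i\ge1}u_{m_1}\wedge\dots\wedge u_{m_i-k}\wedge\cdots$ (only the $i$th factor changed). For given $N$, $H_+=\sum_{k\ge1}\sum_{j=1}^Ns_k^{(j)}J_k$, $e^{H_+}=\sum_{m\ge0}H_+^m/m!$. Lattice model (indexed by strict $\lambda,\mu$). Grid with $N$ rows labelled $1,\dots,N$ from bottom to top, $M+1$ columns labelled $0,\dots,M$ from left to right, $M\ge\max(\lambda_1,\mu_1)$; edges carry spins $\pm$; left and right boundary edges all $+$; bottom boundary edges $-$ exactly on parts of $\lambda$; top boundary edges $-$ exactly on parts of $\mu$. Admissible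 vertices in row $i$, written (left, top, right, bottom): $\mathtt a_1^{(i)}=(+,+,+,+)$, $\mathtt a_2^{(i)}=(-,-,-,-)$, $\mathtt b_1^{(i)}=(+,-,+,-)$, $\mathtt b_2^{(i)}=(-,+,-,+)$, $\mathtt c_1^{(i)}=(-,+,+,-)$, $\mathtt c_2^{(i)}=(+,-,-,+)$; the same symbols denote weights; other vertices have weight $0$. $Z$ is the sum over spin assignments to interior edges of the product of vertex weights. *)

theory Defs
  imports Complex_Main "HOL-Library.FuncSet" "HOL-Library.Poly_Mapping"
begin

text \<open>A strict partition is the list of its parts; a part \<open>0\<close> is allowed and counts for the length,
  and the empty list is the partition of length \<open>0\<close>.\<close>

definition strict_partition :: "nat list \<Rightarrow> bool" where
  "strict_partition la \<longleftrightarrow> sorted_wrt (>) la"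

subsection \<open>Fock space\<close>

text \<open>Index set of the basis of semi-infinite wedges. Sequences are indexed from \<open>0\<close>, which only
  shifts the integer \<open>c\<close>.\<close>

typedef wedge_index =
  "{m :: nat \<Rightarrow> int. (\<forall>i j. i < j \<longrightarrow> m j < m i) \<and>
      (\<exists>c. eventually (\<lambda>r. m r = c - int r) sequentially)}"
  morphisms wedge_seq Wedge_index
  by (rule exI[of _ "\<lambda>r. - int r"]) (auto intro: exI[of _ 0])

text \<open>Fock space is the free complex vector space on the basis, that is, finitely supported
  coefficient functions.\<close>

type_synonym fock = "wedge_index \<Rightarrow>\<^sub>0 complex"

definition fock_scale :: "complex \<Rightarrow> fock \<Rightarrow> fock" where
  "fock_scale c v = Poly_Mapping.map ((*) c) v"

text \<open>The wedge \<open>u (m 0) \<and> u (m 1) \<and> \<dots>\<close> of a not necessarily decreasing sequence, reduced by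
  \<open>u a \<and> u b = - u b \<and> u a\<close>: it vanishes if a factor is repeated, and otherwise it is the basis
  vector with the same factors, times the sign of the sorting permutation (the parity of the number
  of inversions). It is only used for sequences differing from a decreasing one in a single entry,
  which have finitely many inversions and, if injective, a unique rearrangement.\<close>

definition wedge :: "(nat \<Rightarrow> int) \<Rightarrow> fock" where
  "wedge m =
    (if inj m
     then Poly_Mapping.single (THE b. range (wedge_seq b) = range m)
            ((-1) ^ card {(i, j). i < j \<and> m i < m j})
     else 0)"

text \<open>\<open>Sum_any\<close> is the sum over the indices with nonzero summand. For \<open>k \<ge> 1\<close> the support is
  finite, because far out the shifted factor \<open>m i - k\<close> already occurs as \<open>m (i + k)\<close>.\<close>

definition J :: "nat \<Rightarrow> fock \<Rightarrow> fock" where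
  "J k v = (\<Sum>b\<in>Poly_Mapping.keys v. fock_scale (Poly_Mapping.lookup v b)
     (Sum_any (\<lambda>i. wedge ((wedge_seq b)(i := wedge_seq b i - int k)))))"

text \<open>For fixed \<open>v\<close>, \<open>J k v = 0\<close> for all large \<open>k\<close>, so the sum over \<open>k\<close> is again finite.\<close>

definition H_plus :: "(nat \<Rightarrow> nat \<Rightarrow> complex) \<Rightarrow> nat \<Rightarrow> fock \<Rightarrow> fock" where
  "H_plus s N v =
     Sum_any (\<lambda>k. if k \<ge> 1 then (\<Sum>j=1..N. fock_scale (s k j) (J k v)) else 0)"

text \<open>Meaningful for locally nilpotent \<open>X\<close>. The operator \<open>H_plus s N\<close> is one, since every \<open>J k\<close> with
  \<open>k \<ge> 1\<close> lowers the (nonnegative) energy \<open>\<Sum>r. m r - (c - r)\<close>.\<close>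

definition fock_exp :: "(fock \<Rightarrow> fock) \<Rightarrow> fock \<Rightarrow> fock" where
  "fock_exp X v = Sum_any (\<lambda>m. fock_scale (1 / fact m) ((X ^^ m) v))"

definition partition_index :: "nat list \<Rightarrow> wedge_index" where
  "partition_index la = Wedge_index
     (\<lambda>r. if r < length la then int (la ! r) else - 1 - int (r - length la))"

definition ket :: "nat list \<Rightarrow> fock" where
  "ket la = Poly_Mapping.single (partition_index la) 1"

definition matrix_coeff :: "nat list \<Rightarrow> (fock \<Rightarrow> fock) \<Rightarrow> nat list \<Rightarrow> complex" where
  "matrix_coeff mu X la = Poly_Mapping.lookup (X (ket la)) (partition_index mu)"

subsection \<open>Six-vertex model\<close>

datatype spin = Plus | Minus

record vertex_weights =
  a1 :: complex
  a2 :: complex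
  b1 :: complex
  b2 :: complex
  c1 :: complex
  c2 :: complex

text \<open>The spin arguments are in the order left, top, right, bottom.\<close>

fun vertex_weight :: "vertex_weights \<Rightarrow> spin \<Rightarrow> spin \<Rightarrow> spin \<Rightarrow> spin \<Rightarrow> complex" where
  "vertex_weight w Plus Plus Plus Plus = a1 w"
| "vertex_weight w Minus Minus Minus Minus = a2 w"
| "vertex_weight w Plus Minus Plus Minus = b1 w"
| "vertex_weight w Minus Plus Minus Plus = b2 w"
| "vertex_weight w Minus Plus Plus Minus = c1 w"
| "vertex_weight w Plus Minus Minus Plus = c2 w"
| "vertex_weight w _ _ _ _ = 0"

text \<open>The vertex in row \<open>i \<in> {1..N}\<close> and column \<open>j \<in> {0..M}\<close> has left edge \<open>h (i, j)\<close>, right edge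
  \<open>h (i, j + 1)\<close>, bottom edge \<open>v (i - 1, j)\<close> and top edge \<open>v (i, j)\<close>. A state assigns spins to all
  edges with the boundary spins prescribed, hence amounts to an assignment to the interior edges.\<close>

definition lattice_states ::
  "nat \<Rightarrow> nat \<Rightarrow> nat list \<Rightarrow> nat list \<Rightarrow> ((nat \<times> nat \<Rightarrow> spin) \<times> (nat \<times> nat \<Rightarrow> spin)) set" where
  "lattice_states N M la mu =
    {(h, v). h \<in> {1..N} \<times> {0..M+1} \<rightarrow>\<^sub>E UNIV \<and> v \<in> {0..N} \<times> {0..M} \<rightarrow>\<^sub>E UNIV \<and>
       (\<forall>i\<in>{1..N}. h (i, 0) = Plus \<and> h (i, M + 1) = Plus) \<and>
       (\<forall>j\<in>{0..M}. (v (0, j) = Minus \<longleftrightarrow> j \<in> set la) \<and> (v (N, j) = Minus \<longleftrightarrow> j \<in> set mu))}"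

definition partition_function ::
  "(nat \<Rightarrow> vertex_weights) \<Rightarrow> nat \<Rightarrow> nat \<Rightarrow> nat list \<Rightarrow> nat list \<Rightarrow> complex" where
  "partition_function w N M la mu =
    (\<Sum>(h, v)\<in>lattice_states N M la mu. \<Prod>i=1..N. \<Prod>j=0..M.
       vertex_weight (w i) (h (i, j)) (v (i, j)) (h (i, j + 1)) (v (i - 1, j)))"

text \<open>The identity \<open>Z = \<Prod>\<^sub>i A\<^sub>i\<^bsup>M+1\<^esup> B\<^sub>i\<^bsup>\<ell>(la)\<^esup> \<langle>mu|e\<^bsup>H\<^esup>|la\<rangle>\<close> for all \<open>la\<close>, \<open>mu\<close>, \<open>N \<ge> 1\<close> and
  \<open>M \<ge> max la\<^sub>1 mu\<^sub>1\<close>; the last condition says that all parts are at most \<open>M\<close>.\<close>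

definition Z_matches_fock ::
  "(nat \<Rightarrow> vertex_weights) \<Rightarrow> (nat \<Rightarrow> complex) \<Rightarrow> (nat \<Rightarrow> complex) \<Rightarrow>
    (nat \<Rightarrow> nat \<Rightarrow> complex) \<Rightarrow> bool" where
  "Z_matches_fock w A B s \<longleftrightarrow>
    (\<forall>la mu N M. strict_partition la \<and> strict_partition mu \<and> N \<ge> 1 \<and> (\<forall>p\<in>set la \<union> set mu. p \<le> M) \<longrightarrow>
       partition_function w N M la mu =
         (\<Prod>i=1..N. A i ^ (M + 1) * B i ^ length la) *
           matrix_coeff mu (fock_exp (H_plus s N)) la)"

end

theory Submission
  imports Defs "HOL-Computational_Algebra.Formal_Power_Series"
begin

text \<open>Since the sea \<open>u (-1) \<and> u (-2) \<and> \<dots>\<close> is filled, the operators \<open>J k\<close> act on the span of the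
  \<open>|\<lambda>\<rangle>\<close> with parts at most \<open>M\<close> as derivations of a finite exterior algebra extending
  \<open>u m \<mapsto> u (m - k)\<close>. Hence \<open>exp (\<Sum>k. s k J k)\<close> is the algebra endomorphism extending
  \<open>u m \<mapsto> \<Sum>k. h k u (m - k)\<close> with \<open>h = exp (\<Sum>k. s k t^k)\<close>; such endomorphisms compose like the series \<open>h\<close>,
  and \<open>h\<close> is read off from one particle moving to site \<open>0\<close>. Dividing out \<open>A\<close> and \<open>B\<close>, the transfer
  matrix of a free fermionic row satisfies the same recursion in its rightmost particle, with
  \<open>h = (1 + y t) / (1 - x t)\<close>, whose logarithm gives the stated \<open>s k\<close>. Conversely, if all partition functions
  match, then each row is such an endomorphism; comparing its entries \<open>(m) \<rightarrow> (0)\<close> with its entry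
  \<open>(2, 1) \<rightarrow> (1, 0)\<close>, a two by two minor, forces the free fermion condition.\<close>

subsection \<open>Creation operators and their antisymmetry\<close>

text \<open>The obstacle is that semi-infinite wedges, with unbounded sums and signs given by
  sorting permutations, resist direct computation. For \<open>k \<ge> 1\<close> a factor of the sea
  can only move onto another factor of the sea, a factor at a nonnegative site cannot move below
  \<open>0\<close>, and no factor moves upwards. So for each \<open>M\<close> the functions on
  subsets of \<open>{..M}\<close> form an invariant model in which all sums are finite. Two details
  shape the converse directions. Only the sums of \<open>s k j\<close> over \<open>j \<le> N\<close>
  are visible, so a single row or a single \<open>s k j\<close> is isolated by comparing
  \<open>N\<close> with \<open>N + 1\<close> rows; the first row is reached only if zero rows, where
  both sides are the identity, are included. The entry with two particles is forced as well: a
  vertex \<open>a2\<close> needs a particle arriving from the right at an occupied site, so no row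
  with one particle sees its weight.\<close>

text \<open>A function \<open>f\<close> on sets of sites stands for the exterior vector \<open>\<Sum>S. f S u\<^sub>S\<close>, and \<open>create M m\<close> is left
  multiplication by \<open>u m\<close>. Counting only sites up to \<open>M\<close> in the sign makes the anticommutation
  relations hold for infinite \<open>S\<close> as well.\<close>

definition order_sign :: "nat \<Rightarrow> nat \<Rightarrow> nat set \<Rightarrow> complex" where
  "order_sign M m S = (-1) ^ card {j \<in> S. m < j \<and> j \<le> M}"

definition create :: "nat \<Rightarrow> nat \<Rightarrow> (nat set \<Rightarrow> complex) \<Rightarrow> nat set \<Rightarrow> complex" where
  "create M m f = (\<lambda>S. if m \<in> S then order_sign M m S * f (S - {m}) else 0)"

text \<open>Contraction with the covector dual to \<open>u m\<close>, the transpose of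
  \<open>create M m\<close>.\<close>

definition annih :: "nat \<Rightarrow> nat \<Rightarrow> (nat set \<Rightarrow> complex) \<Rightarrow> nat set \<Rightarrow> complex" where
  "annih M m f = (\<lambda>S. if m \<in> S then 0 else order_sign M m S * f (insert m S))"

definition basis_fun :: "nat set \<Rightarrow> nat set \<Rightarrow> complex" where
  "basis_fun R = (\<lambda>S. if S = R then 1 else 0)"

lemma order_sign_insert:
  assumes "n \<notin> S"
  shows "order_sign M m (insert n S) = (if m < n \<and> n \<le> M then - order_sign M m S else order_sign M m S)"
proof (cases "m < n \<and> n \<le> M")
  case True
  then have "{j \<in> insert n S. m < j \<and> j \<le> M} = insert n {j \<in> S. m < j \<and> j \<le> M}" by auto
  moreover have "finite {j \<in> S. m < j \<and> j \<le> M}" by (rule finite_subset[of _ "{..M}"]) auto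
  ultimately show ?thesis using True assms by (simp add: order_sign_def)
next
  case False
  then have "{j \<in> insert n S. m < j \<and> j \<le> M} = {j \<in> S. m < j \<and> j \<le> M}" by auto
  then show ?thesis using False by (simp only: order_sign_def if_False)
qed

lemma order_sign_remove:
  assumes "n \<in> S"
  shows "order_sign M m (S - {n}) = (if m < n \<and> n \<le> M then - order_sign M m S else order_sign M m S)"
  using order_sign_insert[of n "S - {n}" M m] insert_Diff[OF assms] by (auto split: if_splits)

lemma order_sign_max:
  assumes "\<And>j. j \<in> S \<Longrightarrow> j \<le> m"
  shows "order_sign M m S = 1"
proof -
  have "{j \<in> S. m < j \<and> j \<le> M} = {}" using assms by fastforce
  then show ?thesis by (simp only: order_sign_def card.empty power_0)
qed

lemma order_sign_square: "order_sign M m S * order_sign M m S = 1"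
  unfolding order_sign_def by (simp add: power_mult_distrib[symmetric])

lemma order_sign_square_left: "order_sign M m S * (order_sign M m S * c) = c"
  using order_sign_square[of M m S] by (simp add: mult.assoc[symmetric])

text \<open>Removing a site flips only the signs of smaller sites, so exactly one of the two orders
  picks up a minus.\<close>

lemma create_swap:
  assumes "m \<le> M" "n \<le> M"
  shows "create M m (create M n f) S = - create M n (create M m f) S"
proof -
  have "S - {m} - {n} = S - {n} - {m}" by auto
  then show ?thesis using assms
    by (cases m n rule: linorder_cases) (auto simp: create_def order_sign_remove)
qed

lemma create_create_same: "create M m (create M m f) S = 0"
  by (simp add: create_def)

text \<open>The canonical anticommutation relation. It is what makes \<open>shift_op\<close> below a
  derivation.\<close>

lemma create_annih:
  assumes "m \<le> M" "n \<le> M"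
  shows "annih M m (create M n f) S = (if m = n then f S else 0) - create M n (annih M m f) S"
proof (cases "m = n")
  case True
  then show ?thesis
    by (auto simp: create_def annih_def order_sign_insert order_sign_remove insert_absorb
        order_sign_square_left)
next
  case False
  then have "insert m S - {n} = insert m (S - {n})" by auto
  then show ?thesis using assms False
    by (auto simp: create_def annih_def order_sign_insert order_sign_remove)
qed

lemma create_sum: "create M m (\<lambda>S. \<Sum>i\<in>I. c i * f i S) S = (\<Sum>i\<in>I. c i * create M m (f i) S)"
  by (simp add: create_def sum_distrib_left mult.left_commute)

lemma create_add: "create M m (\<lambda>S. f S + g S) S = create M m f S + create M m g S"
  by (simp add: create_def algebra_simps)

lemma create_diff: "create M m (\<lambda>S. f S - g S) S = create M m f S - create M m g S"
  by (simp add: create_def algebra_simps)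

lemma create_scale: "create M m (\<lambda>S. c * f S) S = c * create M m f S"
  by (simp add: create_def)

lemma create_zero: "create M m (\<lambda>S. 0) S = 0"
  by (simp add: create_def)

text \<open>A new largest factor is multiplied on at the left without a sign. For this reason the
  inductions over sets of sites add a maximum.\<close>

lemma create_basis_fun:
  assumes "m \<notin> R" "\<And>j. j \<in> R \<Longrightarrow> j < m"
  shows "create M m (basis_fun R) = basis_fun (insert m R)"
proof
  fix S
  have "order_sign M m (insert m R) = 1"
    using assms(2) by (intro order_sign_max) (auto simp: less_imp_le)
  then show "create M m (basis_fun R) S = basis_fun (insert m R) S"
    using assms(1) by (auto simp: create_def basis_fun_def)
qed

section \<open>Multiplication by the image of a generator\<close>

text \<open>Left multiplication by the image of \<open>u m\<close> under the endomorphism with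
  series \<open>h\<close>. The sum ends at \<open>k = m\<close> because the negative sites belong to
  the filled sea.\<close>

definition vertex_op :: "nat \<Rightarrow> complex fps \<Rightarrow> nat \<Rightarrow> (nat set \<Rightarrow> complex) \<Rightarrow> nat set \<Rightarrow> complex" where
  "vertex_op M h m f = (\<lambda>S. \<Sum>k\<le>m. fps_nth h k * create M (m - k) f S)"

lemma vertex_op_sum:
  "vertex_op M h m (\<lambda>S. \<Sum>i\<in>I. c i * f i S) S = (\<Sum>i\<in>I. c i * vertex_op M h m (f i) S)"
  unfolding vertex_op_def create_sum sum_distrib_left
  by (subst sum.swap) (simp add: mult.left_commute)

lemma vertex_op_scale: "vertex_op M h m (\<lambda>S. c * f S) S = c * vertex_op M h m f S"
  by (simp add: vertex_op_def create_scale sum_distrib_left mult.left_commute)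

lemma vertex_op_zero: "vertex_op M h m (\<lambda>S. 0) S = 0"
  by (simp add: vertex_op_def create_zero)

lemma vertex_op_swap:
  assumes "m \<le> M" "n \<le> M"
  shows "vertex_op M h m (vertex_op M h n f) S = - vertex_op M h n (vertex_op M h m f) S"
proof -
  have *: "vertex_op M h m (vertex_op M h n f) S =
      (\<Sum>k\<le>m. \<Sum>l\<le>n. fps_nth h k * (fps_nth h l * create M (m - k) (create M (n - l) f) S))" for m n
    by (subst (1) vertex_op_def, subst vertex_op_def)
      (simp add: create_sum sum_distrib_left)
  have "vertex_op M h m (vertex_op M h n f) S =
      (\<Sum>k\<le>m. \<Sum>l\<le>n. - (fps_nth h l * (fps_nth h k * create M (n - l) (create M (m - k) f) S)))"
    unfolding * using assms
    by (intro sum.cong refl) (subst create_swap, auto simp: mult.left_commute)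
  also have "\<dots> = - vertex_op M h n (vertex_op M h m f) S"
    unfolding * by (subst sum.swap) (simp add: sum_negf)
  finally show ?thesis .
qed

lemma vertex_op_same:
  assumes "m \<le> M"
  shows "vertex_op M h m (vertex_op M h m f) S = 0"
  using vertex_op_swap[OF assms assms, of h f S] by simp

text \<open>Substituting one linear map of generators into another convolves the coefficients. This
  is why composition of endomorphisms becomes multiplication of series.\<close>

lemma vertex_op_mult:
  "(\<Sum>k\<le>m. fps_nth g k * vertex_op M h (m - k) f S) = vertex_op M (g * h) m f S"
proof -
  have "(\<Sum>k\<le>m. fps_nth g k * vertex_op M h (m - k) f S) =
      (\<Sum>k\<le>m. \<Sum>l\<le>m-k. fps_nth g k * fps_nth h l * create M (m - (k + l)) f S)"
    by (simp add: vertex_op_def sum_distrib_left mult.assoc)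
  also have "\<dots> = (\<Sum>(k,l)\<in>{(i,j). i+j \<le> m}. fps_nth g k * fps_nth h l * create M (m - (k + l)) f S)"
    by (subst sum.Sigma) (auto intro!: sum.cong)
  also have "\<dots> = (\<Sum>n\<le>m. \<Sum>i\<le>n. fps_nth g i * fps_nth h (n - i) * create M (m - n) f S)"
    by (subst sum.triangle_reindex_eq) (auto intro!: sum.cong)
  also have "\<dots> = vertex_op M (g * h) m f S"
    by (simp add: vertex_op_def fps_mult_nth sum_distrib_right atLeast0AtMost)
  finally show ?thesis .
qed

text \<open>\<open>wedge_image M h R\<close> is the image of \<open>u\<^sub>R\<close> under the algebra endomorphism extending
  \<open>u m \<mapsto> \<Sum>k. h k u (m - k)\<close>.\<close>

fun wedge_image_list :: "nat \<Rightarrow> complex fps \<Rightarrow> nat list \<Rightarrow> nat set \<Rightarrow> complex" where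
  "wedge_image_list M h [] = basis_fun {}"
| "wedge_image_list M h (m # ms) = vertex_op M h m (wedge_image_list M h ms)"

definition wedge_image :: "nat \<Rightarrow> complex fps \<Rightarrow> nat set \<Rightarrow> nat set \<Rightarrow> complex" where
  "wedge_image M h R = wedge_image_list M h (rev (sorted_list_of_set R))"

lemma wedge_image_empty: "wedge_image M h {} = basis_fun {}"
  by (simp add: wedge_image_def)

lemma sorted_list_of_set_insert_greater:
  assumes "finite R" "\<And>j. j \<in> R \<Longrightarrow> j < (m::nat)"
  shows "sorted_list_of_set (insert m R) = sorted_list_of_set R @ [m]"
proof -
  have "set (sorted_list_of_set R @ [m]) = insert m R"
    using assms by simp
  moreover have "sorted (sorted_list_of_set R @ [m])" "distinct (sorted_list_of_set R @ [m])"
    using assms by (auto simp: sorted_append less_imp_le)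
  ultimately show ?thesis
    using sorted_list_of_set.idem_if_sorted_distinct by metis
qed

lemma wedge_image_insert:
  assumes "finite R" "\<And>j. j \<in> R \<Longrightarrow> j < m"
  shows "wedge_image M h (insert m R) = vertex_op M h m (wedge_image M h R)"
  unfolding wedge_image_def by (subst sorted_list_of_set_insert_greater) (use assms in auto)

subsection \<open>Composition and exponentials\<close>

text \<open>The new factor is moved past the larger ones to its place, which costs one sign each,
  and it vanishes against an equal factor. This is the sign rule of \<open>create\<close> on basis
  vectors, now for their images.\<close>

lemma vertex_op_wedge_image:
  assumes "Q \<subseteq> {..M}" "m \<le> M"
  shows "vertex_op M g m (wedge_image M g Q) =
    (\<lambda>S. if m \<in> Q then 0 else order_sign M m Q * wedge_image M g (insert m Q) S)"
proof -
  have "finite Q" using assms(1) finite_subset by blast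
  then show ?thesis using assms
  proof (induction Q arbitrary: m rule: finite_linorder_max_induct)
    case empty
    have "wedge_image M g {m} = vertex_op M g m (wedge_image M g {})"
      using wedge_image_insert[of "{}" m M g] by simp
    then show ?case by (auto simp: order_sign_def)
  next
    case (insert q Q)
    have qM: "q \<le> M" "Q \<subseteq> {..M}" using insert.prems by auto
    have W: "wedge_image M g (insert q Q) = vertex_op M g q (wedge_image M g Q)"
      using insert.hyps by (intro wedge_image_insert) auto
    consider "q < m" | "m = q" | "m < q" by linarith
    then show ?case
    proof cases
      case 1
      then have less: "j < m" if "j \<in> insert q Q" for j
        using that insert.hyps by fastforce
      then have "wedge_image M g (insert m (insert q Q)) = vertex_op M g m (wedge_image M g (insert q Q))"
        using insert.hyps by (intro wedge_image_insert) auto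
      moreover have "order_sign M m (insert q Q) = 1"
        using less by (intro order_sign_max less_imp_le)
      moreover have "m \<notin> insert q Q" using less by blast
      ultimately show ?thesis by simp
    next
      case 2
      then show ?thesis using qM by (simp add: W vertex_op_same)
    next
      case 3
      have "vertex_op M g m (wedge_image M g (insert q Q)) S =
        (if m \<in> insert q Q then 0
         else order_sign M m (insert q Q) * wedge_image M g (insert m (insert q Q)) S)" for S
      proof -
        have IH: "vertex_op M g m (wedge_image M g Q) =
          (\<lambda>S. if m \<in> Q then 0 else order_sign M m Q * wedge_image M g (insert m Q) S)"
          using insert.IH[OF qM(2) insert.prems(2)] .
        \<comment> \<open>Passing the outermost factor \<open>q\<close> produces a minus, which is
          the contribution of \<open>q\<close> to \<open>order_sign M m\<close>.\<close>
        have "vertex_op M g m (wedge_image M g (insert q Q)) S =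
            - vertex_op M g q (vertex_op M g m (wedge_image M g Q)) S"
            unfolding W using qM(1) insert.prems(2) by (intro vertex_op_swap)
        also have "\<dots> = - (if m \<in> Q then 0
            else order_sign M m Q * vertex_op M g q (wedge_image M g (insert m Q)) S)"
          unfolding IH by (simp add: vertex_op_zero vertex_op_scale)
        also have "vertex_op M g q (wedge_image M g (insert m Q)) =
            wedge_image M g (insert q (insert m Q))"
          using insert.hyps 3 by (intro wedge_image_insert[symmetric]) auto
        also have "order_sign M m Q = - order_sign M m (insert q Q)"
          using order_sign_insert[of q Q M m] insert.hyps 3 qM by auto
        finally show ?thesis using 3 by (simp add: insert_commute)
      qed
      then show ?thesis by blast
    qed
  qed
qed

text \<open>The meeting point of both sides: the exponential and the free fermionic row are each
  shown to obey this recursion in the largest particle, and are never compared entry by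
  entry.\<close>

lemma wedge_image_unique:
  assumes "K {} = basis_fun {}"
    and "\<And>m R. m \<le> M \<Longrightarrow> \<forall>j\<in>R. j < m \<Longrightarrow> K (insert m R) = vertex_op M h m (K R)"
    and "R \<subseteq> {..M}"
  shows "K R = wedge_image M h R"
proof -
  have "finite R" using assms(3) finite_subset by blast
  then show ?thesis using assms(3)
  proof (induction R rule: finite_linorder_max_induct)
    case empty
    then show ?case using assms(1) by (simp add: wedge_image_empty)
  next
    case (insert m R)
    then show ?case by (simp add: assms(2) wedge_image_insert)
  qed
qed

text \<open>The linear extension of \<open>wedge_image M g\<close> to all vectors respects
  multiplication by a generator, so it is an algebra endomorphism.\<close>

lemma sum_create_wedge_image:
  assumes "m \<le> M"
  shows "(\<Sum>Q\<in>Pow {..M}. create M m f Q * wedge_image M g Q S) =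
    vertex_op M g m (\<lambda>S. \<Sum>Q\<in>Pow {..M}. f Q * wedge_image M g Q S) S"
proof -
  have "(\<Sum>Q\<in>Pow {..M}. create M m f Q * wedge_image M g Q S) =
      (\<Sum>Q | Q \<in> Pow {..M} \<and> m \<in> Q. order_sign M m Q * f (Q - {m}) * wedge_image M g Q S)"
    by (subst sum.inter_filter) (auto simp: create_def intro!: sum.cong)
  also have "\<dots> = (\<Sum>Q | Q \<in> Pow {..M} \<and> m \<notin> Q.
      order_sign M m Q * f Q * wedge_image M g (insert m Q) S)"
    using assms
    by (intro sum.reindex_bij_witness[of _ "insert m" "\<lambda>Q. Q - {m}"])
      (auto simp: order_sign_remove insert_absorb)
  also have "\<dots> = (\<Sum>Q\<in>Pow {..M}. f Q * vertex_op M g m (wedge_image M g Q) S)"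
    by (subst sum.inter_filter)
      (auto simp: vertex_op_wedge_image assms intro!: sum.cong)
  finally show ?thesis by (simp add: vertex_op_sum)
qed

text \<open>The entries of \<open>wedge_image\<close> are minors of Toeplitz matrices, so this is an instance of the
  Cauchy--Binet formula. It is obtained here from the anticommutation of the operators \<open>vertex_op\<close>.\<close>

lemma wedge_image_compose:
  assumes "R \<subseteq> {..M}"
  shows "(\<Sum>Q\<in>Pow {..M}. wedge_image M h R Q * wedge_image M g Q S) = wedge_image M (h * g) R S"
proof -
  have fin: "finite (Pow {..M})" by simp
  have "finite R" using assms finite_subset by blast
  then have "\<forall>S. (\<Sum>Q\<in>Pow {..M}. wedge_image M h R Q * wedge_image M g Q S) = wedge_image M (h * g) R S"
    using assms
  proof (induction R rule: finite_linorder_max_induct)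
    case empty
    have "(\<Sum>Q\<in>Pow {..M}. wedge_image M h {} Q * wedge_image M g Q S) = wedge_image M g {} S" for S
      using sum.delta[OF fin, of "{}" "\<lambda>Q. wedge_image M g Q S"]
      by (simp add: wedge_image_empty basis_fun_def if_distrib[of "\<lambda>c. c * _"] cong: if_cong)
    then show ?case by (simp add: wedge_image_empty)
  next
    case (insert m R)
    have m: "m \<le> M" using insert.prems by auto
    have IH: "(\<lambda>S. \<Sum>Q\<in>Pow {..M}. wedge_image M h R Q * wedge_image M g Q S) = wedge_image M (h * g) R"
      using insert by blast
    have W: "wedge_image M h (insert m R) = vertex_op M h m (wedge_image M h R)" for h
      using insert.hyps by (intro wedge_image_insert) auto
    show ?case
    proof
      fix S
      have "(\<Sum>Q\<in>Pow {..M}. wedge_image M h (insert m R) Q * wedge_image M g Q S) =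
          (\<Sum>k\<le>m. fps_nth h k *
            (\<Sum>Q\<in>Pow {..M}. create M (m - k) (wedge_image M h R) Q * wedge_image M g Q S))"
        unfolding W vertex_op_def sum_distrib_right sum_distrib_left
        by (subst sum.swap) (simp add: mult.assoc)
      \<comment> \<open>The first map spreads \<open>u m\<close> over the \<open>u (m - k)\<close>,
        the second one replaces each of these by its own image, and the induction hypothesis treats
        the remaining factors.\<close>
      also have "\<dots> = (\<Sum>k\<le>m. fps_nth h k * vertex_op M g (m - k) (wedge_image M (h * g) R) S)"
        using m by (simp add: sum_create_wedge_image IH)
      also have "\<dots> = wedge_image M (h * g) (insert m R) S"
        by (simp add: vertex_op_mult W)
      finally show "(\<Sum>Q\<in>Pow {..M}. wedge_image M h (insert m R) Q * wedge_image M g Q S) =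
        wedge_image M (h * g) (insert m R) S" .
    qed
  qed
  then show ?thesis by blast
qed

section \<open>Shifts as derivations\<close>

text \<open>The finite counterpart of \<open>J k\<close>: targets \<open>n\<close> are nonnegative
  because the sea blocks the others, and sources \<open>n + k\<close> do not exceed
  \<open>M\<close>. Hence \<open>k \<le> M\<close> suffices in \<open>H_op\<close>.\<close>

definition shift_op :: "nat \<Rightarrow> nat \<Rightarrow> (nat set \<Rightarrow> complex) \<Rightarrow> nat set \<Rightarrow> complex" where
  "shift_op M k f = (\<lambda>S. \<Sum>n | n + k \<le> M. create M n (annih M (n + k) f) S)"

definition H_op :: "nat \<Rightarrow> complex fps \<Rightarrow> (nat set \<Rightarrow> complex) \<Rightarrow> nat set \<Rightarrow> complex" where
  "H_op M \<sigma> f = (\<lambda>S. \<Sum>k=1..M. fps_nth \<sigma> k * shift_op M k f S)"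

lemma finite_shift_range: "finite {n. n + k \<le> (M::nat)}"
  by (rule finite_subset[of _ "{..M}"]) auto

text \<open>The Leibniz rule. Carrying \<open>u m\<close> through the annihilator and then through
  the creator gives two signs that cancel; the contraction term with \<open>n + k = m\<close> leaves
  \<open>u (m - k)\<close>.\<close>

lemma shift_op_create:
  assumes "m \<le> M"
  shows "shift_op M k (create M m f) S =
    create M m (shift_op M k f) S + (if k \<le> m then create M (m - k) f S else 0)"
proof -
  have summand: "create M n (annih M (n + k) (create M m f)) S =
      (if n + k = m then create M n f S else 0) + create M m (create M n (annih M (n + k) f)) S"
    if "n + k \<le> M" for n
  proof -
    have "annih M (n + k) (create M m f) =
        (\<lambda>S. (if n + k = m then f S else 0) - create M m (annih M (n + k) f) S)"
      using that assms by (auto simp: create_annih)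
    then have "create M n (annih M (n + k) (create M m f)) S =
        create M n (\<lambda>S. if n + k = m then f S else 0) S - create M n (create M m (annih M (n + k) f)) S"
      by (simp only: create_diff)
    also have "create M n (create M m (annih M (n + k) f)) S = - create M m (create M n (annih M (n + k) f)) S"
      using that assms by (intro create_swap) auto
    finally show ?thesis by (cases "n + k = m") (simp_all add: create_zero)
  qed
  have "create M m (shift_op M k f) S = (\<Sum>n | n + k \<le> M. create M m (create M n (annih M (n + k) f)) S)"
    using create_sum[of M m "\<lambda>_. 1" _ "{n. n + k \<le> M}" S] unfolding shift_op_def by simp
  moreover have "(\<Sum>n | n + k \<le> M. if n + k = m then create M n f S else 0) =
      (if k \<le> m then create M (m - k) f S else 0)"
  proof (cases "k \<le> m")
    case True
    then have "(\<Sum>n | n + k \<le> M. if n + k = m then create M n f S else 0) =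
        (\<Sum>n | n + k \<le> M. if n = m - k then create M n f S else 0)"
      by (intro sum.cong refl) auto
    then show ?thesis using True assms by (simp add: finite_shift_range)
  next
    case False
    then show ?thesis by (auto intro!: sum.neutral)
  qed
  ultimately show ?thesis
    unfolding shift_op_def[of M k "create M m f"] by (simp add: summand sum.distrib)
qed

lemma annih_sum: "annih M m (\<lambda>S. \<Sum>i\<in>I. c i * f i S) S = (\<Sum>i\<in>I. c i * annih M m (f i) S)"
  by (simp add: annih_def sum_distrib_left mult.left_commute)

lemma shift_op_sum: "shift_op M k (\<lambda>S. \<Sum>i\<in>I. c i * f i S) S = (\<Sum>i\<in>I. c i * shift_op M k (f i) S)"
  unfolding shift_op_def annih_sum create_sum sum_distrib_left by (rule sum.swap)

lemma H_op_sum: "H_op M \<sigma> (\<lambda>S. \<Sum>i\<in>I. c i * f i S) S = (\<Sum>i\<in>I. c i * H_op M \<sigma> (f i) S)"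
  unfolding H_op_def shift_op_sum sum_distrib_left
  by (subst sum.swap) (simp add: mult.left_commute)

lemma H_op_create:
  assumes "m \<le> M" "fps_nth \<sigma> 0 = 0"
  shows "H_op M \<sigma> (create M m f) S = create M m (H_op M \<sigma> f) S + vertex_op M \<sigma> m f S"
proof -
  have "vertex_op M \<sigma> m f S = (\<Sum>k\<in>{1..m}. fps_nth \<sigma> k * create M (m - k) f S)"
    unfolding vertex_op_def using assms(2)
    by (intro sum.mono_neutral_right) (auto simp: not_le)
  also have "\<dots> = (\<Sum>k=1..M. fps_nth \<sigma> k * (if k \<le> m then create M (m - k) f S else 0))"
    using assms(1) by (intro sum.mono_neutral_cong_left) auto
  finally have "vertex_op M \<sigma> m f S = \<dots>" .
  then show ?thesis
    unfolding H_op_def create_sum by (simp add: shift_op_create assms distrib_left sum.distrib)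
qed

text \<open>The commutator with \<open>H_op\<close> acts on the series of a factor as multiplication
  by \<open>\<sigma>\<close>, which turns an exponential of operators into one of series.\<close>

lemma H_op_vertex_op:
  assumes "m \<le> M" "fps_nth \<sigma> 0 = 0"
  shows "H_op M \<sigma> (vertex_op M g m f) S = vertex_op M g m (H_op M \<sigma> f) S + vertex_op M (\<sigma> * g) m f S"
proof -
  have "H_op M \<sigma> (vertex_op M g m f) S =
      (\<Sum>i\<le>m. fps_nth g i * (create M (m - i) (H_op M \<sigma> f) S + vertex_op M \<sigma> (m - i) f S))"
    unfolding vertex_op_def[of M g m f] H_op_sum
    using assms by (intro sum.cong refl) (subst H_op_create, auto)
  also have "\<dots> = vertex_op M g m (H_op M \<sigma> f) S + vertex_op M (g * \<sigma>) m f S"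
    unfolding distrib_left sum.distrib vertex_op_mult by (simp add: vertex_op_def)
  finally show ?thesis by (simp add: mult.commute)
qed

lemma sum_binomial_Suc:
  fixes a :: "nat \<Rightarrow> nat \<Rightarrow> complex"
  shows "(\<Sum>j\<le>n. of_nat (n choose j) * (a j (Suc (n - j)) + a (Suc j) (n - j))) =
    (\<Sum>j\<le>Suc n. of_nat (Suc n choose j) * a j (Suc n - j))"
proof -
  \<comment> \<open>The range may be extended to \<open>Suc n\<close> because
    \<open>n choose Suc n\<close> is \<open>0\<close>; what follows is Pascal's rule.\<close>
  have "(\<Sum>j\<le>n. of_nat (n choose j) * a j (Suc (n - j))) =
      (\<Sum>j\<le>Suc n. of_nat (n choose j) * a j (Suc n - j))"
    by (auto simp: Suc_diff_le intro!: sum.cong)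
  also have "\<dots> = a 0 (Suc n) + (\<Sum>j\<le>n. of_nat (n choose Suc j) * a (Suc j) (n - j))"
    by (subst sum.atMost_Suc_shift) simp
  finally show ?thesis
    by (subst sum.atMost_Suc_shift) (simp add: distrib_left distrib_right sum.distrib)
qed

text \<open>The iterated Leibniz rule: \<open>j\<close> of the \<open>n\<close> derivations hit the
  first factor, each multiplying its series by \<open>\<sigma>\<close>, and the others pass on to
  \<open>f\<close>.\<close>

lemma H_op_pow_vertex_op:
  assumes "m \<le> M" "fps_nth \<sigma> 0 = 0"
  shows "(H_op M \<sigma> ^^ n) (vertex_op M 1 m f) S =
    (\<Sum>j\<le>n. of_nat (n choose j) * vertex_op M (\<sigma> ^ j) m ((H_op M \<sigma> ^^ (n - j)) f) S)"
proof (induction n arbitrary: S)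
  case (Suc n)
  have "(H_op M \<sigma> ^^ n) (vertex_op M 1 m f) =
    (\<lambda>S. \<Sum>j\<le>n. of_nat (n choose j) * vertex_op M (\<sigma> ^ j) m ((H_op M \<sigma> ^^ (n - j)) f) S)"
    using Suc.IH by blast
  then have "(H_op M \<sigma> ^^ Suc n) (vertex_op M 1 m f) S =
      (\<Sum>j\<le>n. of_nat (n choose j) * (vertex_op M (\<sigma> ^ j) m ((H_op M \<sigma> ^^ Suc (n - j)) f) S +
        vertex_op M (\<sigma> ^ Suc j) m ((H_op M \<sigma> ^^ (n - j)) f) S))"
    by (simp add: H_op_sum H_op_vertex_op assms)
  also have "\<dots> = (\<Sum>j\<le>Suc n. of_nat (Suc n choose j) *
      vertex_op M (\<sigma> ^ j) m ((H_op M \<sigma> ^^ (Suc n - j)) f) S)"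
    by (rule sum_binomial_Suc)
  finally show ?case .
qed simp

section \<open>Nilpotency and the exponential of a derivation\<close>

text \<open>The cut at \<open>M\<close> keeps the sum meaningful for infinite \<open>S\<close>, on
  which functions are also defined.\<close>

definition energy :: "nat \<Rightarrow> nat set \<Rightarrow> nat" where
  "energy M S = \<Sum> (S \<inter> {..M})"

lemma energy_le: "energy M S \<le> \<Sum> {..M}"
  unfolding energy_def by (rule sum_mono2) auto

text \<open>Read from the output back to the input: a coefficient at \<open>S\<close> stems from a
  set whose moved particle was \<open>k \<ge> 1\<close> sites higher. As the energy is bounded, this
  gives a bound on nilpotency that is uniform in \<open>f\<close> and \<open>S\<close>.\<close>

lemma H_op_raises_energy:
  assumes "H_op M \<sigma> f S \<noteq> 0"
  obtains R where "f R \<noteq> 0" "energy M S < energy M R"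
proof -
  obtain k where k: "k \<in> {1..M}" "shift_op M k f S \<noteq> 0"
    using assms unfolding H_op_def by (metis (no_types, lifting) mult_zero_right sum.neutral)
  then obtain n where n: "n + k \<le> M" "create M n (annih M (n + k) f) S \<noteq> 0"
    unfolding shift_op_def by (metis (no_types, lifting) mem_Collect_eq sum.neutral)
  then have S: "n \<in> S" "n + k \<notin> S - {n}" and f: "f (insert (n + k) (S - {n})) \<noteq> 0"
    by (auto simp: create_def annih_def split: if_splits)
  have "insert (n + k) (S - {n}) \<inter> {..M} = insert (n + k) (S \<inter> {..M} - {n})"
    using n by auto
  then have "energy M (insert (n + k) (S - {n})) = n + k + \<Sum> (S \<inter> {..M} - {n})"
    using S by (simp add: energy_def)
  moreover have "energy M S = n + \<Sum> (S \<inter> {..M} - {n})"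
    unfolding energy_def using S n by (subst sum.remove[of _ n]) auto
  ultimately have "energy M S < energy M (insert (n + k) (S - {n}))" using k by simp
  with f show ?thesis using that by blast
qed

lemma H_op_pow_energy:
  assumes "(H_op M \<sigma> ^^ n) f S \<noteq> 0"
  shows "energy M S + n \<le> \<Sum> {..M}"
  using assms
proof (induction n arbitrary: S)
  case 0
  then show ?case using energy_le[of M S] by simp
next
  case (Suc n)
  then obtain R where "(H_op M \<sigma> ^^ n) f R \<noteq> 0" "energy M S < energy M R"
    using H_op_raises_energy[of M \<sigma> "(H_op M \<sigma> ^^ n) f" S] by auto
  then show ?case using Suc.IH[of R] by simp
qed

lemma H_op_nilpotent:
  assumes "\<Sum> {..M} < n"
  shows "(H_op M \<sigma> ^^ n) f S = 0"
  using H_op_pow_energy[of n M \<sigma> f S] assms by auto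

definition exp_op :: "nat \<Rightarrow> complex fps \<Rightarrow> (nat set \<Rightarrow> complex) \<Rightarrow> nat set \<Rightarrow> complex" where
  "exp_op M \<sigma> f = (\<lambda>S. \<Sum>n\<le>\<Sum> {..M}. (1 / fact n) * (H_op M \<sigma> ^^ n) f S)"

lemma exp_op_extend:
  assumes "\<Sum> {..M} \<le> L"
  shows "exp_op M \<sigma> f S = (\<Sum>n\<le>L. (1 / fact n) * (H_op M \<sigma> ^^ n) f S)"
  unfolding exp_op_def using assms
  by (intro sum.mono_neutral_left) (auto simp: H_op_nilpotent not_le)

text \<open>The exponential of a derivation is multiplicative, and on the series of the first factor
  it multiplies by the exponential of \<open>\<sigma>\<close>.\<close>

lemma exp_op_create:
  assumes m: "m \<le> M" and \<sigma>: "fps_nth \<sigma> 0 = 0"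
  shows "exp_op M \<sigma> (create M m f) S = vertex_op M (fps_exp 1 oo \<sigma>) m (exp_op M \<sigma> f) S"
proof -
  define e where "e = \<Sum> {..M}"
  define a where "a j l = 1 / (fact j * fact l) * vertex_op M (\<sigma> ^ j) m ((H_op M \<sigma> ^^ l) f) S" for j l
  have create: "create M m f = vertex_op M 1 m f"
    using m by (auto simp: vertex_op_def fps_one_nth if_distrib[of "\<lambda>c. c * _"] cong: if_cong)
  \<comment> \<open>For \<open>j > M\<close> the series \<open>\<sigma> ^ j\<close> starts beyond
    degree \<open>m\<close>; for \<open>l > e\<close> the power of \<open>H_op\<close>
    vanishes.\<close>
  have zero: "a j l = 0" if "j > M \<or> l > e" for j l
  proof (cases "j > M")
    case True
    then have "vertex_op M (\<sigma> ^ j) m g S = 0" for g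
      using \<sigma> m by (auto simp: vertex_op_def startsby_zero_power_prefix intro!: sum.neutral)
    then show ?thesis by (simp add: a_def)
  next
    case False
    then have "(H_op M \<sigma> ^^ l) f = (\<lambda>S. 0)" using that by (auto simp: H_op_nilpotent e_def)
    then show ?thesis by (simp add: a_def vertex_op_zero)
  qed
  \<comment> \<open>The cutoff \<open>M + e\<close> makes the triangle of pairs
    \<open>(j, l)\<close> contain the whole rectangle where \<open>a\<close> can be nonzero, so that
    the double sum factors.\<close>
  have "exp_op M \<sigma> (create M m f) S = (\<Sum>n\<le>M + e. \<Sum>j\<le>n. a j (n - j))"
    unfolding create
    by (subst exp_op_extend[of _ "M + e"])
      (auto simp: H_op_pow_vertex_op m \<sigma> e_def a_def sum_distrib_left binomial_fact intro!: sum.cong)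
  also have "\<dots> = (\<Sum>(j, l)\<in>{(j, l). j + l \<le> M + e}. a j l)"
    by (subst sum.triangle_reindex_eq) simp
  also have "\<dots> = (\<Sum>(j, l)\<in>{..M} \<times> {..e}. a j l)"
  proof (rule sum.mono_neutral_right)
    show "finite {(j, l). j + l \<le> M + e}"
      by (rule finite_subset[of _ "{..M + e} \<times> {..M + e}"]) auto
  qed (auto, (use zero not_le in blast)+)
  also have "\<dots> = (\<Sum>j\<le>M. 1 / fact j * vertex_op M (\<sigma> ^ j) m (exp_op M \<sigma> f) S)"
    unfolding exp_op_def vertex_op_sum
    by (simp add: sum.cartesian_product[symmetric] e_def a_def sum_distrib_left)
  also have "\<dots> = vertex_op M (fps_exp 1 oo \<sigma>) m (exp_op M \<sigma> f) S"
  proof -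
    have "(\<Sum>j\<le>M. 1 / fact j * fps_nth (\<sigma> ^ j) k) = fps_nth (fps_exp 1 oo \<sigma>) k" if "k \<le> m" for k
      unfolding fps_compose_nth using that m \<sigma>
      by (intro sum.mono_neutral_cong_right) (auto simp: startsby_zero_power_prefix)
    then have "vertex_op M (fps_exp 1 oo \<sigma>) m (exp_op M \<sigma> f) S =
      (\<Sum>k\<le>m. (\<Sum>j\<le>M. 1 / fact j * fps_nth (\<sigma> ^ j) k) * create M (m - k) (exp_op M \<sigma> f) S)"
      by (simp add: vertex_op_def)
    also have "\<dots> = (\<Sum>j\<le>M. 1 / fact j * vertex_op M (\<sigma> ^ j) m (exp_op M \<sigma> f) S)"
      unfolding vertex_op_def sum_distrib_left sum_distrib_right
      by (subst sum.swap) (simp add: mult.assoc)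
    finally show ?thesis by simp
  qed
  finally show ?thesis .
qed

lemma H_op_vacuum: "H_op M \<sigma> (basis_fun {}) = (\<lambda>S. 0)"
  by (rule ext) (auto simp: H_op_def shift_op_def create_def annih_def basis_fun_def intro!: sum.neutral)

lemma exp_op_vacuum: "exp_op M \<sigma> (basis_fun {}) = basis_fun {}"
proof
  fix S
  have zero: "H_op M \<sigma> (\<lambda>S. 0) = (\<lambda>S. 0)"
    by (rule ext) (auto simp: H_op_def shift_op_def create_def annih_def intro!: sum.neutral)
  have pow: "(H_op M \<sigma> ^^ n) (basis_fun {}) = (if n = 0 then basis_fun {} else (\<lambda>S. 0))" for n
    by (induction n) (auto simp: H_op_vacuum zero)
  have "exp_op M \<sigma> (basis_fun {}) S = (\<Sum>n\<le>\<Sum> {..M}. if n = 0 then basis_fun {} S else 0)"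
    unfolding exp_op_def by (intro sum.cong) (auto simp: pow)
  then show "exp_op M \<sigma> (basis_fun {}) S = basis_fun {} S" by simp
qed

lemma exp_op_basis_fun:
  assumes "R \<subseteq> {..M}" "fps_nth \<sigma> 0 = 0"
  shows "exp_op M \<sigma> (basis_fun R) = wedge_image M (fps_exp 1 oo \<sigma>) R"
proof (rule wedge_image_unique)
  fix m R assume "m \<le> M" "\<forall>j\<in>R. j < m"
  then have "basis_fun (insert m R) = create M m (basis_fun R)"
    using create_basis_fun[of m R M] by auto
  then show "exp_op M \<sigma> (basis_fun (insert m R)) =
      vertex_op M (fps_exp 1 oo \<sigma>) m (exp_op M \<sigma> (basis_fun R))"
    using exp_op_create \<open>m \<le> M\<close> assms(2) by auto
qed (use assms exp_op_vacuum in auto)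

subsection \<open>The current operators on semi-infinite wedges\<close>

lemma lookup_fock_scale: "Poly_Mapping.lookup (fock_scale c v) b = c * Poly_Mapping.lookup v b"
  by (simp add: fock_scale_def Poly_Mapping.map.rep_eq when_def)

lemma fock_scale_single: "fock_scale c (Poly_Mapping.single b d) = Poly_Mapping.single b (c * d)"
  by (rule poly_mapping_eqI) (simp add: lookup_fock_scale lookup_single when_def)

lemma fock_scale_zero: "fock_scale 0 v = 0" "fock_scale c 0 = 0"
  by (rule poly_mapping_eqI, simp add: lookup_fock_scale)+

lemma fock_scale_sum: "fock_scale c (\<Sum>i\<in>I. v i) = (\<Sum>i\<in>I. fock_scale c (v i))"
  by (rule poly_mapping_eqI) (simp add: lookup_fock_scale lookup_sum sum_distrib_left)

lemma wedge_seq_decreasing: "i < j \<Longrightarrow> wedge_seq b j < wedge_seq b i"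
  using wedge_seq[of b] by auto

lemma wedge_seq_le: "i \<le> j \<Longrightarrow> wedge_seq b j \<le> wedge_seq b i"
  using wedge_seq_decreasing[of i j b] by (cases "i = j") auto

lemma inj_wedge_seq: "inj (wedge_seq b)"
  by (rule injI) (metis wedge_seq_decreasing less_irrefl linorder_neqE_nat)

text \<open>A decreasing sequence lists its range from the top, so each entry is the largest one not
  yet listed. This makes the definite description in \<open>wedge\<close> unique.\<close>

lemma wedge_index_eqI:
  assumes "range (wedge_seq a) = range (wedge_seq b)"
  shows "a = b"
proof -
  have le: "wedge_seq a r \<le> wedge_seq b r"
    if eq: "range (wedge_seq a) = range (wedge_seq b)"
      and less: "\<And>i. i < r \<Longrightarrow> wedge_seq a i = wedge_seq b i" for a b r
  proof -
    obtain j where j: "wedge_seq a r = wedge_seq b j" using eq by (metis rangeE rangeI)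
    have "r \<le> j"
    proof (rule ccontr)
      assume "\<not> r \<le> j"
      then have "wedge_seq a j = wedge_seq a r" using less j by simp
      then show False using wedge_seq_decreasing[of j r a] \<open>\<not> r \<le> j\<close> by simp
    qed
    then show ?thesis using j wedge_seq_le by simp
  qed
  have "wedge_seq a r = wedge_seq b r" for r
  proof (induction r rule: less_induct)
    case (less r)
    show ?case using le[OF assms, of r] le[OF assms[symmetric], of r] less by force
  qed
  then show ?thesis by (simp add: wedge_seq_inject[symmetric] fun_eq_iff)
qed

lemma partition_seq:
  assumes "strict_partition la"
  shows "wedge_seq (partition_index la) =
    (\<lambda>r. if r < length la then int (la ! r) else - 1 - int (r - length la))"
proof -
  let ?m = "\<lambda>r. if r < length la then int (la ! r) else - 1 - int (r - length la)"
  have "\<forall>\<^sub>F r in sequentially. ?m r = (int (length la) - 1) - int r"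
    using eventually_ge_at_top[of "length la"] by eventually_elim auto
  then have "\<exists>c. \<forall>\<^sub>F r in sequentially. ?m r = c - int r" by blast
  moreover have "la ! j < la ! i" if "i < j" "j < length la" for i j
    using assms that sorted_wrt_nth_less unfolding strict_partition_def by blast
  then have "\<forall>i j. i < j \<longrightarrow> ?m j < ?m i" by auto
  ultimately show ?thesis unfolding partition_index_def
    by (intro Wedge_index_inverse) blast
qed

text \<open>Names the wedge with completely filled sea by its occupied nonnegative sites; it is
  meant for finite \<open>S\<close>.\<close>

definition set_index :: "nat set \<Rightarrow> wedge_index" where
  "set_index S = partition_index (rev (sorted_list_of_set S))"

lemma strict_partition_sorted_list: "strict_partition (rev (sorted_list_of_set S))"
  by (simp add: strict_partition_def sorted_wrt_rev)

lemma partition_index_eq_set_index: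
  assumes "strict_partition la"
  shows "partition_index la = set_index (set la)"
proof -
  have s: "sorted_wrt (<) (rev la)" using assms by (simp add: strict_partition_def sorted_wrt_rev)
  then have "sorted (rev la)" "distinct (rev la)"
    by (simp_all add: strict_sorted_iff)
  then have "sorted_list_of_set (set (rev la)) = rev la"
    by (rule sorted_list_of_set.idem_if_sorted_distinct)
  then show ?thesis by (simp add: set_index_def)
qed

lemma set_index_seq:
  "wedge_seq (set_index S) = (\<lambda>r. if r < card S then int (rev (sorted_list_of_set S) ! r)
     else - 1 - int (r - card S))"
  unfolding set_index_def by (subst partition_seq[OF strict_partition_sorted_list]) (simp add: fun_eq_iff)

lemma range_set_index:
  assumes "finite S"
  shows "range (wedge_seq (set_index S)) = int ` S \<union> {..<0}"
proof -
  define la where "la = rev (sorted_list_of_set S)"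
  have la: "length la = card S" "set la = S" using assms by (simp_all add: la_def)
  have seq: "wedge_seq (set_index S) = (\<lambda>r. if r < card S then int (la ! r) else - 1 - int (r - card S))"
    by (simp add: set_index_seq la_def fun_eq_iff)
  have "wedge_seq (set_index S) ` {..<card S} = int ` S"
  proof -
    have "wedge_seq (set_index S) ` {..<card S} = int ` ((!) la ` {..<length la})"
      by (auto simp: seq la image_image)
    also have "(!) la ` {..<length la} = S"
      using la by (auto simp: set_conv_nth)
    finally show ?thesis .
  qed
  moreover have "wedge_seq (set_index S) ` {card S..} = {..<0}"
  proof
    show "{..<0} \<subseteq> wedge_seq (set_index S) ` {card S..}"
    proof
      fix z :: int assume "z \<in> {..<0}"
      then have "z = wedge_seq (set_index S) (card S + nat (- 1 - z))" by (simp add: seq)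
      then show "z \<in> wedge_seq (set_index S) ` {card S..}" by (metis atLeast_iff image_eqI le_add1)
    qed
  qed (auto simp: seq)
  moreover have "(UNIV :: nat set) = {..<card S} \<union> {card S..}" by auto
  ultimately show ?thesis by (metis image_Un)
qed

lemma set_index_inj: "finite S \<Longrightarrow> finite R \<Longrightarrow> set_index S = set_index R \<longleftrightarrow> S = R"
proof
  assume "finite S" "finite R" "set_index S = set_index R"
  then have "int ` S \<union> {..<0} = int ` R \<union> {..<0}" by (metis range_set_index)
  then have "int x \<in> int ` S \<union> {..<0} \<longleftrightarrow> int x \<in> int ` R \<union> {..<0}" for x
    by (simp only:)
  then have "x \<in> S \<longleftrightarrow> x \<in> R" for x by (auto simp: inj_image_mem_iff)
  then show "S = R" by blast
qed simp

lemma wedge_shift_vanishing: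
  assumes "k \<ge> 1" "wedge_seq b i - int k \<in> range (wedge_seq b)"
  shows "wedge ((wedge_seq b)(i := wedge_seq b i - int k)) = 0"
proof -
  obtain j where j: "wedge_seq b i - int k = wedge_seq b j" using assms(2) by blast
  then have "j \<noteq> i" using assms(1) by auto
  then have "\<not> inj ((wedge_seq b)(i := wedge_seq b i - int k))"
    using j by (metis fun_upd_other fun_upd_same injD)
  then show ?thesis by (simp add: wedge_def)
qed

text \<open>Lowering one entry of a decreasing sequence creates inversions only with the entries it
  jumps over. As the target is nonnegative, these all lie in \<open>S\<close> and none in the
  sea.\<close>

lemma wedge_shift:
  assumes "finite S" and i: "wedge_seq (set_index S) i = int (n + k)" and n: "n \<notin> S"
  shows "wedge ((wedge_seq (set_index S))(i := wedge_seq (set_index S) i - int k)) =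
    Poly_Mapping.single (set_index (insert n (S - {n + k})))
      ((-1) ^ card {j \<in> S. n < j \<and> j < n + k})"
proof -
  define m where "m = wedge_seq (set_index S)"
  define m' where "m' = m(i := int n)"
  have eq: "(wedge_seq (set_index S))(i := wedge_seq (set_index S) i - int k) = m'"
    by (simp add: m'_def m_def i)
  have rm: "range m = int ` S \<union> {..<0}" using assms(1) by (simp add: m_def range_set_index)
  have mi: "m i = int (n + k)" by (simp add: m_def i)
  have inj: "inj m" by (simp add: m_def inj_wedge_seq)
  have notin: "int n \<notin> range m" using n by (auto simp: rm)
  have "inj m'" unfolding m'_def using inj notin by (metis inj_on_fun_updI)
  moreover have "(THE b. range (wedge_seq b) = range m') = set_index (insert n (S - {n + k}))"
  proof (rule the_equality)
    have "m ` (UNIV - {i}) = range m - {m i}" using inj by (auto simp: inj_def)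
    then have "range m' = insert (int n) (range m - {int (n + k)})"
      by (simp only: m'_def fun_upd_image mi) simp
    also have "\<dots> = int ` insert n (S - {n + k}) \<union> {..<0}" unfolding rm by auto
    finally have r: "range m' = int ` insert n (S - {n + k}) \<union> {..<0}" .
    then show R: "range (wedge_seq (set_index (insert n (S - {n + k})))) = range m'"
      using assms(1) by (simp add: range_set_index)
    show "b = set_index (insert n (S - {n + k}))" if "range (wedge_seq b) = range m'" for b
      using that R by (intro wedge_index_eqI) simp
  qed
  moreover have "card {(i', j). i' < j \<and> m' i' < m' j} = card {j \<in> S. n < j \<and> j < n + k}"
  proof -
    have dec: "m j < m i'" if "i' < j" for i' j using that by (simp add: m_def wedge_seq_decreasing)
    \<comment> \<open>Every inversion has the changed position \<open>i\<close> as its left member,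
      since lowering an entry cannot disturb the order with entries before it unless it becomes the
      left one.\<close>
    have "{(i', j). i' < j \<and> m' i' < m' j} = Pair i ` {j. i < j \<and> int n < m j}"
    proof -
      have "i' = i \<and> int n < m j" if "i' < j" "m' i' < m' j" for i' j
        using that dec[of i' j] mi by (auto simp: m'_def split: if_splits)
      moreover have "m' i < m' j" if "i < j" "int n < m j" for j
        using that by (simp add: m'_def)
      ultimately show ?thesis by blast
    qed
    then have "card {(i', j). i' < j \<and> m' i' < m' j} = card {j. i < j \<and> int n < m j}"
      by (simp add: card_image inj_on_def)
    also have "\<dots> = card (m ` {j. i < j \<and> int n < m j})"
      using inj by (metis card_image inj_on_subset subset_UNIV)
    also have "m ` {j. i < j \<and> int n < m j} = int ` {j \<in> S. n < j \<and> j < n + k}"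
    proof -
      have "i < j \<longleftrightarrow> m j < int (n + k)" for j
        using dec[of i j] dec[of j i] mi by (cases i j rule: linorder_cases) auto
      then have "m ` {j. i < j \<and> int n < m j} = {z \<in> range m. int n < z \<and> z < int (n + k)}" by auto
      also have "\<dots> = int ` {j \<in> S. n < j \<and> j < n + k}" unfolding rm by auto
      finally show ?thesis .
    qed
    also have "card \<dots> = card {j \<in> S. n < j \<and> j < n + k}" by (simp add: card_image)
    finally show ?thesis .
  qed
  ultimately show ?thesis unfolding eq by (simp add: wedge_def)
qed

text \<open>Only moves from an occupied to an empty site survive. Such a move is determined by its
  target, so the sum over positions of factors becomes one over sites.\<close>

lemma J_summands:
  assumes "finite S" "k \<ge> 1"
  shows "Sum_any (\<lambda>i. wedge ((wedge_seq (set_index S))(i := wedge_seq (set_index S) i - int k))) =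
    (\<Sum>n | n + k \<in> S \<and> n \<notin> S. Poly_Mapping.single (set_index (insert n (S - {n + k})))
      ((-1) ^ card {j \<in> S. n < j \<and> j < n + k}))"
proof -
  define b where "b = set_index S"
  define F where "F n = Poly_Mapping.single (set_index (insert n (S - {n + k})))
      ((-1) ^ card {j \<in> S. n < j \<and> j < n + k} :: complex)" for n
  define X where "X = {n. n + k \<in> S \<and> n \<notin> S}"
  define w where "w i = wedge ((wedge_seq b)(i := wedge_seq b i - int k))" for i
  define pos where "pos n = inv (wedge_seq b) (int (n + k))" for n
  have pos: "wedge_seq b (pos n) = int (n + k)" if "n \<in> X" for n
    unfolding pos_def using that assms(1)
    by (intro f_inv_into_f) (auto simp: b_def range_set_index X_def simp del: of_nat_add)
  have inj: "inj_on pos X"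
    using pos by (intro inj_onI) (metis add_right_cancel of_nat_eq_iff)
  have fin: "finite X"
    using assms(1) by (intro finite_subset[of X "(\<lambda>n. n - k) ` S"]) (force simp: X_def)+
  have "w i = 0" if "i \<notin> pos ` X" for i
  proof (cases "wedge_seq b i - int k \<in> range (wedge_seq b)")
    case True
    then show ?thesis using assms(2) by (simp add: w_def wedge_shift_vanishing)
  next
    case False
    have r: "range (wedge_seq b) = int ` S \<union> {..<0}"
      using assms(1) by (simp add: b_def range_set_index)
    \<comment> \<open>All negative sites are occupied, so an unoccupied target is nonnegative, and
      the source lies above it.\<close>
    have F: "wedge_seq b i \<in> int ` S \<union> {..<0}"
      "wedge_seq b i - int k \<notin> int ` S" "wedge_seq b i - int k \<ge> 0"
      using False rangeI[of "wedge_seq b" i] unfolding r by auto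
    define n where "n = nat (wedge_seq b i - int k)"
    have n: "int n = wedge_seq b i - int k" using F by (simp add: n_def)
    then have nk: "int (n + k) = wedge_seq b i" by simp
    then have "int (n + k) \<in> int ` S" using F(1) by auto
    then have "n + k \<in> S" by (simp only: inj_image_mem_iff[OF inj_of_nat])
    moreover have "n \<notin> S" using F(2) n by (metis imageI)
    ultimately have "n \<in> X" by (simp add: X_def)
    then have "i = pos n" using nk pos inj_wedge_seq by (metis injD)
    then show ?thesis using that \<open>n \<in> X\<close> by blast
  qed
  then have "Sum_any w = sum w (pos ` X)"
    using fin by (intro Sum_any.expand_superset) auto
  also have "\<dots> = (\<Sum>n\<in>X. F n)"
    unfolding sum.reindex[OF inj]
  proof (intro sum.cong refl, simp only: comp_apply)
    fix n assume "n \<in> X"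
    then show "w (pos n) = F n"
      unfolding w_def b_def F_def using assms(1) pos by (intro wedge_shift) (auto simp: b_def X_def)
  qed
  finally show ?thesis by (simp add: w_def[abs_def] b_def F_def X_def)
qed

section \<open>Transport of the finite model to Fock space\<close>

definition fock_of :: "nat \<Rightarrow> (nat set \<Rightarrow> complex) \<Rightarrow> fock" where
  "fock_of M f = (\<Sum>S\<in>Pow {..M}. Poly_Mapping.single (set_index S) (f S))"

lemma finite_of_Pow: "S \<in> Pow {..M::nat} \<Longrightarrow> finite S"
  using finite_subset by auto

lemma lookup_fock_of:
  assumes "R \<subseteq> {..M}"
  shows "Poly_Mapping.lookup (fock_of M f) (set_index R) = f R"
proof -
  have "Poly_Mapping.lookup (fock_of M f) (set_index R) = (\<Sum>S\<in>Pow {..M}. if S = R then f S else 0)"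
    unfolding fock_of_def lookup_sum lookup_single when_def
    using assms by (intro sum.cong refl) (metis PowI finite_of_Pow set_index_inj)
  then show ?thesis using assms by simp
qed

lemma keys_fock_of: "Poly_Mapping.keys (fock_of M f) \<subseteq> set_index ` Pow {..M}"
  unfolding fock_of_def by (rule order_trans[OF keys_sum]) (auto split: if_splits)

lemma single_sum: "Poly_Mapping.single b (\<Sum>i\<in>I. c i) = (\<Sum>i\<in>I. Poly_Mapping.single b (c i :: complex))"
  by (rule poly_mapping_eqI) (simp add: lookup_sum lookup_single when_def)

lemma fock_scale_fock_of: "fock_scale c (fock_of M f) = fock_of M (\<lambda>S. c * f S)"
  by (simp add: fock_of_def fock_scale_sum fock_scale_single)

lemma sum_fock_of: "(\<Sum>i\<in>I. fock_of M (f i)) = fock_of M (\<lambda>S. \<Sum>i\<in>I. f i S)"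
  unfolding fock_of_def single_sum by (rule sum.swap)

lemma ket_eq_fock_of:
  assumes "strict_partition la" "set la \<subseteq> {..M}"
  shows "ket la = fock_of M (basis_fun (set la))"
proof -
  have "fock_of M (basis_fun (set la)) =
      (\<Sum>S\<in>Pow {..M}. if S = set la then Poly_Mapping.single (set_index S) 1 else 0)"
    unfolding fock_of_def basis_fun_def by (intro sum.cong) auto
  then show ?thesis using assms by (simp add: ket_def partition_index_eq_set_index)
qed

text \<open>Particles above \<open>n + k\<close> are counted by both signs and cancel. What remains
  are the particles jumped over, in agreement with the inversions of the sorted wedge.\<close>

lemma order_sign_move:
  assumes "n \<in> R" "n + k \<notin> R" "n + k \<le> M"
  shows "order_sign M n R * order_sign M (n + k) (R - {n}) = (-1) ^ card {j \<in> R. n < j \<and> j < n + k}"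
proof -
  define A where "A = {j \<in> R. n < j \<and> j < n + k}"
  define B where "B = {j \<in> R - {n}. n + k < j \<and> j \<le> M}"
  have "{j \<in> R. n < j \<and> j \<le> M} = A \<union> B" using assms by (auto simp: A_def B_def not_less order_le_less)
  moreover have "finite A" "finite B" "A \<inter> B = {}"
    by (auto simp: A_def B_def)
  ultimately have "card {j \<in> R. n < j \<and> j \<le> M} = card A + card B" by (simp add: card_Un_disjoint)
  then show ?thesis
    unfolding order_sign_def A_def[symmetric] B_def[symmetric]
    by (simp add: power_add mult.assoc power_mult_distrib[symmetric])
qed

lemma J_fock_of:
  assumes "k \<ge> 1"
  shows "J k (fock_of M f) = fock_of M (shift_op M k f)"
proof -
  define c where "c n S = (-1 :: complex) ^ card {j \<in> S. n < j \<and> j < n + k}" for n S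
  define move where "move n S = insert n (S - {n + k})" for n S
  define unmove where "unmove n R = insert (n + k) (R - {n})" for n R
  let ?G = "\<lambda>b. Sum_any (\<lambda>i. wedge ((wedge_seq b)(i := wedge_seq b i - int k)))"
  have inj: "inj_on set_index (Pow {..M})"
    by (intro inj_onI) (metis finite_of_Pow set_index_inj)
  have "J k (fock_of M f) = (\<Sum>b\<in>set_index ` Pow {..M}. fock_scale (Poly_Mapping.lookup (fock_of M f) b) (?G b))"
    unfolding J_def
    by (intro sum.mono_neutral_left keys_fock_of) (auto simp: in_keys_iff fock_scale_zero)
  also have "\<dots> = (\<Sum>S\<in>Pow {..M}. fock_scale (f S) (?G (set_index S)))"
    by (subst sum.reindex[OF inj]) (auto simp: lookup_fock_of intro!: sum.cong)
  also have "\<dots> = (\<Sum>S\<in>Pow {..M}. \<Sum>n | n \<in> {n. n + k \<le> M} \<and> n + k \<in> S \<and> n \<notin> S.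
      Poly_Mapping.single (set_index (move n S)) (f S * c n S))"
  proof (rule sum.cong[OF refl])
    fix S assume S: "S \<in> Pow {..M}"
    then have "{n. n \<in> {n. n + k \<le> M} \<and> n + k \<in> S \<and> n \<notin> S} = {n. n + k \<in> S \<and> n \<notin> S}" by auto
    then show "fock_scale (f S) (?G (set_index S)) =
      (\<Sum>n | n \<in> {n. n + k \<le> M} \<and> n + k \<in> S \<and> n \<notin> S.
        Poly_Mapping.single (set_index (move n S)) (f S * c n S))"
      using finite_of_Pow[OF S] assms
      by (simp add: J_summands fock_scale_sum fock_scale_single move_def c_def)
  qed
  \<comment> \<open>For a fixed target \<open>n\<close> the move is a bijection between source and
    result sets; this is why the sum over \<open>n\<close> is taken outside.\<close>
  also have "\<dots> = (\<Sum>n\<in>{n. n + k \<le> M}. \<Sum>S | S \<in> Pow {..M} \<and> n + k \<in> S \<and> n \<notin> S.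
      Poly_Mapping.single (set_index (move n S)) (f S * c n S))"
    by (rule sum.swap_restrict) (auto simp: finite_shift_range)
  also have "\<dots> = (\<Sum>n\<in>{n. n + k \<le> M}. \<Sum>R\<in>Pow {..M}.
      Poly_Mapping.single (set_index R) (create M n (annih M (n + k) f) R))"
  proof (rule sum.cong[OF refl])
    fix n assume n: "n \<in> {n. n + k \<le> M}"
    have "(\<Sum>S | S \<in> Pow {..M} \<and> n + k \<in> S \<and> n \<notin> S.
        Poly_Mapping.single (set_index (move n S)) (f S * c n S)) =
      (\<Sum>R | R \<in> Pow {..M} \<and> n \<in> R \<and> n + k \<notin> R.
        Poly_Mapping.single (set_index R) (create M n (annih M (n + k) f) R))"
    proof (rule sum.reindex_bij_witness[of _ "unmove n" "move n"])
      fix S assume "S \<in> {S. S \<in> Pow {..M} \<and> n + k \<in> S \<and> n \<notin> S}"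
      then have S: "S \<subseteq> {..M}" "n + k \<in> S" "n \<notin> S" by auto
      show u: "unmove n (move n S) = S" using S by (auto simp: move_def unmove_def)
      show "move n S \<in> {R. R \<in> Pow {..M} \<and> n \<in> R \<and> n + k \<notin> R}"
        using S n assms by (auto simp: move_def)
      then have R: "n \<in> move n S" "n + k \<notin> move n S" by auto
      have "create M n (annih M (n + k) f) (move n S) =
          order_sign M n (move n S) * order_sign M (n + k) (move n S - {n}) * f (unmove n (move n S))"
        using R by (simp add: create_def annih_def unmove_def)
      also have "\<dots> = f S * (-1) ^ card {j \<in> move n S. n < j \<and> j < n + k}"
        using R n by (subst order_sign_move) (auto simp: u)
      also have "{j \<in> move n S. n < j \<and> j < n + k} = {j \<in> S. n < j \<and> j < n + k}"
        by (auto simp: move_def)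
      finally show "Poly_Mapping.single (set_index (move n S)) (create M n (annih M (n + k) f) (move n S)) =
          Poly_Mapping.single (set_index (move n S)) (f S * c n S)"
        by (simp add: c_def)
    next
      fix R assume "R \<in> {R. R \<in> Pow {..M} \<and> n \<in> R \<and> n + k \<notin> R}"
      then show "move n (unmove n R) = R" "unmove n R \<in> {S. S \<in> Pow {..M} \<and> n + k \<in> S \<and> n \<notin> S}"
        using n assms by (auto simp: move_def unmove_def)
    qed
    also have "\<dots> = (\<Sum>R\<in>Pow {..M}. Poly_Mapping.single (set_index R) (create M n (annih M (n + k) f) R))"
      using assms by (intro sum.mono_neutral_left) (auto simp: create_def annih_def)
    finally show "(\<Sum>S | S \<in> Pow {..M} \<and> n + k \<in> S \<and> n \<notin> S.
        Poly_Mapping.single (set_index (move n S)) (f S * c n S)) =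
      (\<Sum>R\<in>Pow {..M}. Poly_Mapping.single (set_index R) (create M n (annih M (n + k) f) R))" .
  qed
  also have "\<dots> = fock_of M (shift_op M k f)"
    unfolding fock_of_def shift_op_def single_sum by (rule sum.swap)
  finally show ?thesis .
qed

lemma fock_of_zero: "fock_of M (\<lambda>S. 0) = 0"
  by (simp add: fock_of_def)

text \<open>\<open>J k\<close> does not depend on \<open>j\<close>, so only the sum over
  \<open>j\<close> enters. The zero constant term makes composition with the exponential series
  meaningful.\<close>

definition hamiltonian_series :: "(nat \<Rightarrow> nat \<Rightarrow> complex) \<Rightarrow> nat \<Rightarrow> complex fps" where
  "hamiltonian_series s N = Abs_fps (\<lambda>k. if k = 0 then 0 else \<Sum>j=1..N. s k j)"

lemma H_plus_fock_of:
  "H_plus s N (fock_of M f) = fock_of M (H_op M (hamiltonian_series s N) f)"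
proof -
  define g where "g k = (if k \<ge> 1 then (\<Sum>j=1..N. fock_scale (s k j) (J k (fock_of M f))) else 0)" for k
  have g: "g k = fock_of M (\<lambda>S. fps_nth (hamiltonian_series s N) k * shift_op M k f S)" if "k \<ge> 1" for k
    using that
    by (simp add: g_def J_fock_of fock_scale_fock_of sum_fock_of sum_distrib_right hamiltonian_series_def)
  \<comment> \<open>Within \<open>M + 1\<close> sites above a filled sea no particle can jump
    further than \<open>M\<close>.\<close>
  have zero: "g k = 0" if "k \<notin> {1..M}" for k
  proof (cases "k = 0")
    case False
    then have "shift_op M k f = (\<lambda>S. 0)" using that by (auto simp: shift_op_def)
    then show ?thesis using False by (simp add: g fock_of_zero)
  qed (simp add: g_def)
  have "H_plus s N (fock_of M f) = (\<Sum>k=1..M. g k)"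
    unfolding H_plus_def g_def[symmetric]
    by (rule Sum_any.expand_superset) (simp, use zero in blast)
  also have "\<dots> = (\<Sum>k=1..M. fock_of M (\<lambda>S. fps_nth (hamiltonian_series s N) k * shift_op M k f S))"
    using g by (intro sum.cong) auto
  finally show ?thesis by (simp only: sum_fock_of H_op_def)
qed

lemma fock_exp_fock_of:
  "fock_exp (H_plus s N) (fock_of M f) = fock_of M (exp_op M (hamiltonian_series s N) f)"
proof -
  have pow: "(H_plus s N ^^ n) (fock_of M f) = fock_of M ((H_op M (hamiltonian_series s N) ^^ n) f)" for n
    by (induction n) (simp_all add: H_plus_fock_of)
  define g where "g n = fock_scale (1 / fact n) ((H_plus s N ^^ n) (fock_of M f))" for n
  have g: "g n = fock_of M (\<lambda>S. (1 / fact n) * (H_op M (hamiltonian_series s N) ^^ n) f S)" for n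
    by (simp add: g_def pow fock_scale_fock_of)
  have zero: "g n = 0" if "n \<notin> {..\<Sum> {..M}}" for n
    unfolding g using that by (simp add: H_op_nilpotent fock_of_zero)
  have "fock_exp (H_plus s N) (fock_of M f) = (\<Sum>n\<le>\<Sum> {..M}. g n)"
    unfolding fock_exp_def g_def[symmetric]
    by (rule Sum_any.expand_superset) (simp, use zero in blast)
  then show ?thesis by (simp only: g sum_fock_of exp_op_def)
qed

lemma matrix_coeff_eq_wedge_image:
  assumes "strict_partition la" "strict_partition mu" "set la \<union> set mu \<subseteq> {..M}"
  shows "matrix_coeff mu (fock_exp (H_plus s N)) la =
    wedge_image M (fps_exp 1 oo hamiltonian_series s N) (set la) (set mu)"
proof -
  have "exp_op M (hamiltonian_series s N) (basis_fun (set la)) =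
      wedge_image M (fps_exp 1 oo hamiltonian_series s N) (set la)"
    using assms by (intro exp_op_basis_fun) (auto simp: hamiltonian_series_def)
  then show ?thesis
    using assms unfolding matrix_coeff_def
    by (simp add: ket_eq_fock_of[of la M] fock_exp_fock_of partition_index_eq_set_index lookup_fock_of)
qed

subsection \<open>A single free fermionic row\<close>

definition site :: "nat set \<Rightarrow> nat \<Rightarrow> spin" where
  "site S n = (if n \<in> S then Minus else Plus)"

text \<open>The weight of the sites \<open>0, \<dots>, n - 1\<close> of a row with right boundary spin \<open>r\<close>, bottom spins \<open>R\<close> and
  top spins \<open>S\<close>.\<close>

fun row_weight :: "vertex_weights \<Rightarrow> nat \<Rightarrow> spin \<Rightarrow> nat set \<Rightarrow> nat set \<Rightarrow> complex" where
  "row_weight w 0 r R S = (if r = Plus then 1 else 0)"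
| "row_weight w (Suc n) r R S =
    vertex_weight w Plus (site S n) r (site R n) * row_weight w n Plus R S +
    vertex_weight w Minus (site S n) r (site R n) * row_weight w n Minus R S"

text \<open>The row of \<open>n\<close> sites as an exterior vector supported on those sites, so
  that a particle leaving through the top of the next site is a \<open>create\<close>.\<close>

definition row_fun :: "vertex_weights \<Rightarrow> nat \<Rightarrow> spin \<Rightarrow> nat set \<Rightarrow> nat set \<Rightarrow> complex" where
  "row_fun w n r R = (\<lambda>S. if S \<subseteq> {..<n} then row_weight w n r R S else 0)"

lemma row_fun_0_Minus: "row_fun w 0 Minus R = (\<lambda>S. 0)"
  by (simp add: row_fun_def fun_eq_iff)

lemma row_weight_cong:
  assumes "\<And>j. j < n \<Longrightarrow> j \<in> R \<longleftrightarrow> j \<in> R'" "\<And>j. j < n \<Longrightarrow> j \<in> S \<longleftrightarrow> j \<in> S'"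
  shows "row_weight w n r R S = row_weight w n r R' S'"
  using assms by (induction n arbitrary: r) (simp_all add: site_def)

lemma row_fun_cong:
  assumes "\<And>j. j < n \<Longrightarrow> j \<in> R \<longleftrightarrow> j \<in> R'"
  shows "row_fun w n r R = row_fun w n r R'"
  unfolding row_fun_def using row_weight_cong[of n R R'] assms by auto

lemma create_row_fun:
  "create M n (row_fun w n l R) S = (if n \<in> S \<and> S \<subseteq> {..<Suc n} then row_weight w n l R S else 0)"
proof (cases "n \<in> S \<and> S \<subseteq> {..<Suc n}")
  case True
  then have "order_sign M n S = 1" by (intro order_sign_max) auto
  moreover have "S - {n} \<subseteq> {..<n}" using True by (auto simp: less_Suc_eq)
  moreover have "row_weight w n l R (S - {n}) = row_weight w n l R S" by (rule row_weight_cong) auto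
  ultimately show ?thesis using True by (simp add: create_def row_fun_def)
next
  case False
  then have "n \<notin> S \<or> \<not> S - {n} \<subseteq> {..<n}" by (auto simp: less_Suc_eq subset_iff)
  then show ?thesis using False by (auto simp: create_def row_fun_def)
qed

text \<open>\<open>M\<close> is arbitrary here: site \<open>n\<close> lies above all sites in the
  support, so its sign is \<open>1\<close>.\<close>

lemma row_fun_Suc:
  "row_fun w (Suc n) Plus R = (\<lambda>S.
    if n \<in> R then b1 w * create M n (row_fun w n Plus R) S + c1 w * row_fun w n Minus R S
    else a1 w * row_fun w n Plus R S)"
  "row_fun w (Suc n) Minus R = (\<lambda>S.
    if n \<in> R then a2 w * create M n (row_fun w n Minus R) S
    else b2 w * row_fun w n Minus R S + c2 w * create M n (row_fun w n Plus R) S)"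
proof -
  have *: "n \<notin> S \<Longrightarrow> S \<subseteq> {..<Suc n} \<longleftrightarrow> S \<subseteq> {..<n}" "S \<subseteq> {..<n} \<Longrightarrow> n \<notin> S" for S
    by (auto simp: less_Suc_eq subset_iff)
  show "row_fun w (Suc n) Plus R = (\<lambda>S.
    if n \<in> R then b1 w * create M n (row_fun w n Plus R) S + c1 w * row_fun w n Minus R S
    else a1 w * row_fun w n Plus R S)"
    unfolding create_row_fun using * by (auto simp: row_fun_def site_def fun_eq_iff)
  show "row_fun w (Suc n) Minus R = (\<lambda>S.
    if n \<in> R then a2 w * create M n (row_fun w n Minus R) S
    else b2 w * row_fun w n Minus R S + c2 w * create M n (row_fun w n Plus R) S)"
    unfolding create_row_fun using * by (auto simp: row_fun_def site_def fun_eq_iff)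
qed

text \<open>Weights of a particle entering over the right edge: \<open>k\<close> passages of weight
  \<open>b2 = x\<close>, then an exit upwards by \<open>c2 = 1\<close>.\<close>

definition geometric :: "complex \<Rightarrow> complex fps" where
  "geometric x = Abs_fps (\<lambda>k. x ^ k)"

text \<open>Weights of a particle starting inside the row: straight up by \<open>b1 = 1\<close>, or
  a left turn \<open>c1\<close>, then \<open>k - 1\<close> passages \<open>b2\<close> and an exit
  \<open>c2\<close>.\<close>

definition row_series :: "complex \<Rightarrow> complex \<Rightarrow> complex fps" where
  "row_series x y = Abs_fps (\<lambda>k. if k = 0 then 1 else (x + y) * x ^ (k - 1))"

definition free_fermionic :: "complex \<Rightarrow> complex \<Rightarrow> vertex_weights" where
  "free_fermionic x y = \<lparr>a1 = 1, a2 = y, b1 = 1, b2 = x, c1 = x + y, c2 = 1\<rparr>"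

lemma free_fermionic_simps [simp]:
  "a1 (free_fermionic x y) = 1" "a2 (free_fermionic x y) = y" "b1 (free_fermionic x y) = 1"
  "b2 (free_fermionic x y) = x" "c1 (free_fermionic x y) = x + y" "c2 (free_fermionic x y) = 1"
  by (simp_all add: free_fermionic_def)

lemma vertex_op_add: "vertex_op M h m (\<lambda>S. f S + g S) S = vertex_op M h m f S + vertex_op M h m g S"
  by (simp add: vertex_op_def create_add distrib_left sum.distrib)

lemma create_vertex_op:
  assumes "m \<le> M" "n \<le> M"
  shows "create M n (vertex_op M h m f) S = - vertex_op M h m (create M n f) S"
proof -
  have "create M n (vertex_op M h m f) S = (\<Sum>k\<le>m. fps_nth h k * create M n (create M (m - k) f) S)"
    unfolding vertex_op_def by (rule create_sum)
  also have "\<dots> = (\<Sum>k\<le>m. - (fps_nth h k * create M (m - k) (create M n f) S))"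
    using assms by (intro sum.cong refl) (subst create_swap, auto)
  finally show ?thesis by (simp add: vertex_op_def sum_negf)
qed

lemma vertex_op_geometric_Suc:
  "vertex_op M (geometric x) (Suc m) f S = create M (Suc m) f S + x * vertex_op M (geometric x) m f S"
  unfolding vertex_op_def
  by (subst sum.atMost_Suc_shift) (simp add: geometric_def sum_distrib_left mult.assoc)

lemma vertex_op_row_series_Suc:
  "vertex_op M (row_series x y) (Suc m) f S =
    create M (Suc m) f S + (x + y) * vertex_op M (geometric x) m f S"
  unfolding vertex_op_def
  by (subst sum.atMost_Suc_shift) (simp add: geometric_def row_series_def sum_distrib_left mult.assoc)

lemma vertex_op_at_0:
  "fps_nth h 0 = 1 \<Longrightarrow> vertex_op M h 0 f = create M 0 f"
  by (simp add: vertex_op_def)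

text \<open>The free fermion condition enters in the case \<open>Suc m \<in> R\<close>, as \<open>c1 c2 - b2 = a2\<close>.\<close>

lemma row_fun_Minus:
  assumes "m \<le> M"
  shows "row_fun (free_fermionic x y) (Suc m) Minus R =
    vertex_op M (geometric x) m (row_fun (free_fermionic x y) (Suc m) Plus R)"
  using assms
proof (induction m)
  case 0
  define F where "F = row_fun (free_fermionic x y) 0 Plus R"
  have P: "row_fun (free_fermionic x y) (Suc 0) Plus R = (\<lambda>S. if 0 \<in> R then create M 0 F S else F S)"
    unfolding row_fun_Suc[where M = M] row_fun_0_Minus by (simp add: F_def cong: if_cong)
  have "row_fun (free_fermionic x y) (Suc 0) Minus R = (\<lambda>S. if 0 \<in> R then 0 else create M 0 F S)"
    unfolding row_fun_Suc[where M = M] row_fun_0_Minus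
    by (simp add: F_def create_zero cong: if_cong)
  moreover have "vertex_op M (geometric x) 0 f = create M 0 f" for f
    by (rule vertex_op_at_0) (simp add: geometric_def)
  ultimately show ?case
    unfolding P by (cases "0 \<in> R") (simp_all add: create_create_same fun_eq_iff)
next
  case (Suc m)
  let ?w = "free_fermionic x y" and ?V = "vertex_op M (geometric x)" and ?n = "Suc m"
  define F where "F = row_fun ?w ?n Plus R"
  define G where "G = row_fun ?w ?n Minus R"
  have G: "G = ?V m F" using Suc by (simp add: F_def G_def)
  have n: "?n \<le> M" "m \<le> M" using Suc.prems by auto
  show ?case
  proof (cases "?n \<in> R")
    case True
    have P: "row_fun ?w (Suc ?n) Plus R = (\<lambda>S. create M ?n F S + (x + y) * G S)"
      using True by (simp add: row_fun_Suc[where M = M and n = ?n] F_def G_def)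
    have "row_fun ?w (Suc ?n) Minus R S = ?V ?n (row_fun ?w (Suc ?n) Plus R) S" for S
    proof -
      have "?V ?n (row_fun ?w (Suc ?n) Plus R) S =
          (x + y) * create M ?n G S + x * (?V m (create M ?n F) S + (x + y) * ?V m G S)"
        unfolding P vertex_op_geometric_Suc
        by (simp add: create_add create_scale create_create_same vertex_op_add vertex_op_scale)
      also have "?V m G S = 0" unfolding G using n by (simp add: vertex_op_same)
      also have "?V m (create M ?n F) S = - create M ?n G S"
        unfolding G using n by (simp add: create_vertex_op)
      finally show ?thesis
        using True
        by (simp add: row_fun_Suc[where M = M and n = ?n] G_def algebra_simps)
    qed
    then show ?thesis by blast
  next
    case False
    then show ?thesis
      by (simp add: row_fun_Suc[where M = M and n = ?n] F_def[symmetric] G_def[symmetric]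
          vertex_op_geometric_Suc G fun_eq_iff)
  qed
qed

text \<open>To the right of all particles nothing enters from the right or from below, so only
  vertices \<open>a1\<close> of weight \<open>1\<close> are possible.\<close>

lemma row_fun_extend:
  assumes "a1 w = 1" "R \<subseteq> {..<m}" "m \<le> n"
  shows "row_fun w n Plus R = row_fun w m Plus R"
  using assms(3)
proof (induction n rule: dec_induct)
  case (step n)
  then have "n \<notin> R" using assms(2) by auto
  then show ?case using step assms(1) by (simp add: row_fun_Suc[where M = 0])
qed simp

text \<open>The rightmost particle either goes straight up or turns left, and after turning it is a
  particle entering the remaining sites over their right edge.\<close>

lemma row_fun_insert:
  assumes "m \<le> M" "R \<subseteq> {..<m}"
  shows "row_fun (free_fermionic x y) (Suc m) Plus (insert m R) =
    vertex_op M (row_series x y) m (row_fun (free_fermionic x y) m Plus R)"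
proof -
  have cong: "row_fun (free_fermionic x y) m r (insert m R) = row_fun (free_fermionic x y) m r R" for r
    by (rule row_fun_cong) auto
  have step: "row_fun (free_fermionic x y) (Suc m) Plus (insert m R) =
    (\<lambda>S. create M m (row_fun (free_fermionic x y) m Plus R) S +
      (x + y) * row_fun (free_fermionic x y) m Minus R S)"
    by (simp add: row_fun_Suc[where M = M] cong)
  show ?thesis
  proof (cases m)
    case 0
    have "vertex_op M (row_series x y) 0 f = create M 0 f" for f
      by (rule vertex_op_at_0) (simp add: row_series_def)
    then show ?thesis unfolding step by (simp add: 0 row_fun_0_Minus)
  next
    case (Suc m')
    then have "row_fun (free_fermionic x y) m Minus R =
        vertex_op M (geometric x) m' (row_fun (free_fermionic x y) m Plus R)"
      using row_fun_Minus assms(1) by simp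
    then show ?thesis unfolding step by (simp add: Suc vertex_op_row_series_Suc fun_eq_iff)
  qed
qed

lemma free_fermionic_row:
  assumes "R \<subseteq> {..M}" "S \<subseteq> {..M}"
  shows "row_weight (free_fermionic x y) (Suc M) Plus R S = wedge_image M (row_series x y) R S"
proof -
  have "row_fun (free_fermionic x y) (Suc M) Plus R = wedge_image M (row_series x y) R"
  proof (rule wedge_image_unique)
    have "row_fun (free_fermionic x y) (Suc M) Plus {} = row_fun (free_fermionic x y) 0 Plus {}"
      by (rule row_fun_extend) auto
    then show "row_fun (free_fermionic x y) (Suc M) Plus {} = basis_fun {}"
      by (auto simp: row_fun_def basis_fun_def)
  next
    fix m R assume m: "m \<le> M" and R: "\<forall>j\<in>R. j < m"
    have "row_fun (free_fermionic x y) (Suc M) Plus (insert m R) =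
        row_fun (free_fermionic x y) (Suc m) Plus (insert m R)"
      using m R by (intro row_fun_extend) (auto simp: less_Suc_eq)
    also have "\<dots> = vertex_op M (row_series x y) m (row_fun (free_fermionic x y) m Plus R)"
      using m R by (intro row_fun_insert) auto
    also have "row_fun (free_fermionic x y) m Plus R = row_fun (free_fermionic x y) (Suc M) Plus R"
      using m R by (intro row_fun_extend[symmetric]) auto
    finally show "row_fun (free_fermionic x y) (Suc M) Plus (insert m R) =
        vertex_op M (row_series x y) m (row_fun (free_fermionic x y) (Suc M) Plus R)" .
  qed (use assms in auto)
  moreover have "S \<subseteq> {..<Suc M}" using assms(2) by (auto simp: less_Suc_eq_le)
  ultimately show ?thesis by (metis row_fun_def)
qed

section \<open>Exponentials and logarithms of power series\<close>

lemma fps_exp_compose_deriv: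
  assumes "fps_nth (\<sigma> :: complex fps) 0 = 0"
  shows "fps_deriv (fps_exp 1 oo \<sigma>) = fps_deriv \<sigma> * (fps_exp 1 oo \<sigma>)"
  using fps_compose_deriv[OF assms, of "fps_exp 1"] by (simp add: mult.commute)

text \<open>The logarithmic derivative and the constant term determine a series, because the
  quotient of two solutions has derivative zero.\<close>

lemma fps_exp_compose_unique:
  assumes \<sigma>: "fps_nth (\<sigma> :: complex fps) 0 = 0"
    and h: "fps_nth h 0 = 1" "fps_deriv h = fps_deriv \<sigma> * h"
  shows "fps_exp 1 oo \<sigma> = h"
proof -
  define E where "E = fps_exp 1 oo \<sigma>"
  have E: "fps_nth E 0 = 1" "fps_deriv E = fps_deriv \<sigma> * E"
    using \<sigma> by (simp_all add: E_def fps_exp_compose_deriv)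
  have inv: "E * inverse E = 1" using E(1) by (simp add: inverse_mult_eq_1')
  \<comment> \<open>In place of a quotient rule, \<open>h\<close> is differentiated as the product
    of \<open>h / E\<close> and \<open>E\<close>.\<close>
  have "fps_deriv (h * inverse E) * E + (h * inverse E) * fps_deriv E = fps_deriv (h * (inverse E * E))"
    by (simp add: mult.assoc[symmetric])
  also have "\<dots> = fps_deriv h" using inv by (simp add: mult.commute)
  also have "\<dots> = h * inverse E * fps_deriv E"
    unfolding E(2) h(2) using inv by (simp add: algebra_simps)
  finally have "fps_deriv (h * inverse E) * E = 0" by simp
  then have "fps_deriv (h * inverse E) = 0" using E(1) by auto
  moreover have "fps_nth (h * inverse E) 0 = 1" using E(1) h(1) by simp
  ultimately have "h * inverse E = fps_const 1" unfolding fps_deriv_eq_0_iff by metis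
  then have "h = E" using inv by (metis fps_const_1_eq_1 mult.assoc mult.commute mult_1)
  then show ?thesis by (simp add: E_def)
qed

lemma fps_exp_compose_add:
  assumes "fps_nth (\<sigma> :: complex fps) 0 = 0" "fps_nth \<tau> 0 = 0"
  shows "fps_exp 1 oo (\<sigma> + \<tau>) = (fps_exp 1 oo \<sigma>) * (fps_exp 1 oo \<tau>)"
  by (rule fps_exp_compose_unique) (use assms in \<open>simp_all add: fps_exp_compose_deriv algebra_simps\<close>)

lemma fps_exp_compose_inject:
  assumes "fps_nth (\<sigma> :: complex fps) 0 = 0" "fps_nth \<tau> 0 = 0"
    and eq: "fps_exp 1 oo \<sigma> = fps_exp 1 oo \<tau>"
  shows "\<sigma> = \<tau>"
proof -
  have "fps_nth (fps_exp 1 oo \<tau>) 0 = 1" by simp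
  then have "fps_exp 1 oo \<tau> \<noteq> 0" by (metis fps_zero_nth zero_neq_one)
  moreover have "fps_deriv \<sigma> * (fps_exp 1 oo \<tau>) = fps_deriv \<tau> * (fps_exp 1 oo \<tau>)"
    using fps_exp_compose_deriv assms by metis
  ultimately have "fps_deriv \<sigma> = fps_deriv \<tau>" by simp
  then show ?thesis using assms by (simp add: fps_deriv_eq_iff)
qed

text \<open>\<open>log (1 + y t) - log (1 - x t)\<close>; its coefficients are the supersymmetric
  power sums divided by \<open>k\<close>.\<close>

definition supersymmetric_power_series :: "complex \<Rightarrow> complex \<Rightarrow> complex fps" where
  "supersymmetric_power_series x y =
    Abs_fps (\<lambda>k. if k = 0 then 0 else 1 / of_nat k * (x ^ k + (-1) ^ (k - 1) * y ^ k))"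

lemma geometric_inverse: "(1 - fps_const x * fps_X) * geometric x = 1"
proof (rule fps_ext)
  fix n show "fps_nth ((1 - fps_const x * fps_X) * geometric x) n = fps_nth 1 n"
    by (cases n) (simp_all add: geometric_def left_diff_distrib mult.assoc)
qed

lemma geometric_deriv: "fps_deriv (geometric x) = fps_const x * geometric x * geometric x"
proof -
  let ?g = "geometric x" and ?u = "1 - fps_const x * fps_X"
  have "fps_deriv (?u * ?g) = 0" by (simp add: geometric_inverse)
  then have "?u * fps_deriv ?g = fps_const x * ?g" by (simp add: algebra_simps)
  then have "?g * (?u * fps_deriv ?g) = ?g * (fps_const x * ?g)" by simp
  then have "(?u * ?g) * fps_deriv ?g = fps_const x * ?g * ?g" by (simp only: ac_simps)
  then show ?thesis by (simp add: geometric_inverse)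
qed

lemma row_series_eq: "row_series x y = (1 + fps_const y * fps_X) * geometric x"
proof (rule fps_ext)
  fix n show "fps_nth (row_series x y) n = fps_nth ((1 + fps_const y * fps_X) * geometric x) n"
    by (cases n) (simp_all add: row_series_def geometric_def algebra_simps)
qed

lemma supersymmetric_power_series_deriv:
  "fps_deriv (supersymmetric_power_series x y) = fps_const x * geometric x + fps_const y * geometric (- y)"
proof (rule fps_ext)
  fix n
  have "(1 + of_nat n :: complex) \<noteq> 0" by (metis of_nat_Suc of_nat_eq_0_iff nat.distinct(1))
  moreover have "(- y) ^ n = (-1) ^ n * y ^ n" by (rule power_minus)
  ultimately show "fps_nth (fps_deriv (supersymmetric_power_series x y)) n =
      fps_nth (fps_const x * geometric x + fps_const y * geometric (- y)) n"
    by (simp add: supersymmetric_power_series_def geometric_def)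
qed

lemma exp_supersymmetric: "fps_exp 1 oo supersymmetric_power_series x y = row_series x y"
proof (rule fps_exp_compose_unique)
  have inv: "(1 + fps_const y * fps_X) * geometric (- y) = 1"
    using geometric_inverse[of "- y"] by (simp add: fps_const_neg[symmetric] del: fps_const_neg)
  have "fps_deriv (row_series x y) = fps_const y * geometric x +
      fps_const x * geometric x * ((1 + fps_const y * fps_X) * geometric x)"
    by (simp add: row_series_eq geometric_deriv algebra_simps)
  \<comment> \<open>The factor \<open>1 = (1 + y t) / (1 + y t)\<close> is inserted so that
    \<open>row_series\<close> splits off from both terms.\<close>
  also have "fps_const y * geometric x =
      fps_const y * ((1 + fps_const y * fps_X) * geometric (- y)) * geometric x"
    by (simp add: inv)
  finally show "fps_deriv (row_series x y) = fps_deriv (supersymmetric_power_series x y) * row_series x y"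
    by (simp add: supersymmetric_power_series_deriv row_series_eq algebra_simps)
qed (simp_all add: supersymmetric_power_series_def row_series_def)

subsection \<open>Transfer matrices\<close>

lemma UNIV_spin: "(UNIV :: spin set) = {Plus, Minus}"
  using spin.exhaust by auto

lemma finite_spin: "finite (A :: spin set)"
  by (rule finite_subset[OF subset_UNIV]) (simp add: UNIV_spin)

definition row_states :: "nat \<Rightarrow> spin \<Rightarrow> (nat \<Rightarrow> spin) set" where
  "row_states n r = {g \<in> {0..n} \<rightarrow>\<^sub>E UNIV. g 0 = Plus \<and> g n = r}"

lemma finite_row_states: "finite (row_states n r)"
  unfolding row_states_def by (simp add: finite_PiE finite_spin)

text \<open>The recursion splits off the last vertex of the row; the spin of its left edge is the
  right boundary of the rest.\<close>

lemma row_weight_eq_sum: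
  "(\<Sum>g\<in>row_states n r. \<Prod>j<n. vertex_weight w (g j) (site S j) (g (Suc j)) (site R j)) =
    row_weight w n r R S"
proof (induction n arbitrary: r)
  case 0
  have "row_states 0 r = (if r = Plus then {\<lambda>j\<in>{0}. Plus} else {})"
    by (auto simp: row_states_def PiE_def extensional_def restrict_def fun_eq_iff)
  then show ?case by simp
next
  case (Suc n)
  let ?F = "\<lambda>g j. vertex_weight w (g j) (site S j) (g (Suc j)) (site R j)"
  have "(\<Sum>g\<in>row_states (Suc n) r. \<Prod>j<Suc n. ?F g j) =
      (\<Sum>(l, g)\<in>(SIGMA l:{Plus, Minus}. row_states n l).
        vertex_weight w l (site S n) r (site R n) * (\<Prod>j<n. ?F g j))"
  proof (rule sum.reindex_bij_witness[of _ "\<lambda>(l, g). g(Suc n := r)" "\<lambda>g. (g n, restrict g {0..n})"])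
    fix g assume g: "g \<in> row_states (Suc n) r"
    show "(case (g n, restrict g {0..n}) of (l, g) \<Rightarrow> g(Suc n := r)) = g"
      using g by (auto simp: row_states_def PiE_def extensional_def restrict_def fun_eq_iff)
    show "(g n, restrict g {0..n}) \<in> (SIGMA l:{Plus, Minus}. row_states n l)"
      using g spin.exhaust by (auto simp: row_states_def)
    have "(\<Prod>j<n. ?F (restrict g {0..n}) j) = (\<Prod>j<n. ?F g j)"
      by (intro prod.cong) auto
    then show "(case (g n, restrict g {0..n}) of
        (l, g) \<Rightarrow> vertex_weight w l (site S n) r (site R n) * (\<Prod>j<n. ?F g j)) = (\<Prod>j<Suc n. ?F g j)"
      using g by (simp add: row_states_def mult.commute)
  next
    fix p assume p: "p \<in> (SIGMA l:{Plus, Minus}. row_states n l)"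
    obtain l g where lg: "p = (l, g)" by fastforce
    then have g: "g \<in> row_states n l" using p by auto
    then have "g \<in> extensional {0..n}" by (auto simp: row_states_def PiE_def)
    then show "((case p of (l, g) \<Rightarrow> g(Suc n := r)) n,
        restrict (case p of (l, g) \<Rightarrow> g(Suc n := r)) {0..n}) = p"
      using g by (auto simp: lg row_states_def extensional_def restrict_def fun_eq_iff)
    show "(case p of (l, g) \<Rightarrow> g(Suc n := r)) \<in> row_states (Suc n) r"
      using g by (auto simp: lg row_states_def PiE_def extensional_def)
  qed
  also have "\<dots> = (\<Sum>l\<in>{Plus, Minus}. vertex_weight w l (site S n) r (site R n) * row_weight w n l R S)"
    by (subst sum.Sigma[symmetric]) (simp_all add: finite_row_states sum_distrib_left[symmetric] Suc)
  finally show ?case by simp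
qed

text \<open>The boundary is given by sets, so that the vertical spins between two rows can serve as
  a boundary too.\<close>

definition states :: "nat \<Rightarrow> nat \<Rightarrow> nat set \<Rightarrow> nat set \<Rightarrow>
    ((nat \<times> nat \<Rightarrow> spin) \<times> (nat \<times> nat \<Rightarrow> spin)) set" where
  "states N M R S =
    {(h, v). h \<in> {1..N} \<times> {0..M+1} \<rightarrow>\<^sub>E UNIV \<and> v \<in> {0..N} \<times> {0..M} \<rightarrow>\<^sub>E UNIV \<and>
       (\<forall>i\<in>{1..N}. h (i, 0) = Plus \<and> h (i, M + 1) = Plus) \<and>
       (\<forall>j\<in>{0..M}. v (0, j) = site R j \<and> v (N, j) = site S j)}"

lemma lattice_states_eq: "lattice_states N M la mu = states N M (set la) (set mu)"
proof -
  have "(s = Minus \<longleftrightarrow> j \<in> R) \<longleftrightarrow> s = site R j" for s j R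
    by (cases s) (auto simp: site_def)
  then show ?thesis by (simp add: lattice_states_def states_def)
qed

lemma finite_states: "finite (states N M R S)"
  by (rule finite_subset[of _ "({1..N} \<times> {0..M+1} \<rightarrow>\<^sub>E UNIV) \<times> ({0..N} \<times> {0..M} \<rightarrow>\<^sub>E UNIV)"])
    (auto simp: states_def finite_PiE finite_spin)

definition state_weight ::
  "(nat \<Rightarrow> vertex_weights) \<Rightarrow> nat \<Rightarrow> nat \<Rightarrow> (nat \<times> nat \<Rightarrow> spin) \<times> (nat \<times> nat \<Rightarrow> spin) \<Rightarrow> complex" where
  "state_weight w N M = (\<lambda>(h, v). \<Prod>i=1..N. \<Prod>j=0..M.
     vertex_weight (w i) (h (i, j)) (v (i, j)) (h (i, j + 1)) (v (i - 1, j)))"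

text \<open>Without rows the bottom and top edges are the same edges, so the sum over states is the
  identity matrix.\<close>

lemma states_0:
  assumes "R \<subseteq> {..M}" "S \<subseteq> {..M}"
  shows "states 0 M R S =
    (if R = S then {(\<lambda>_. undefined, \<lambda>(i, j)\<in>{0} \<times> {0..M}. site R j)} else {})"
proof (cases "R = S")
  case True
  have "p \<in> states 0 M R S \<longleftrightarrow> p = (\<lambda>_. undefined, \<lambda>(i, j)\<in>{0} \<times> {0..M}. site R j)" for p
  proof
    assume p: "p \<in> states 0 M R S"
    obtain h v where hv: "p = (h, v)" by fastforce
    have h: "h e = undefined" for e
      using p by (auto simp: hv states_def)
    have v: "v (i, j) = undefined" if "i \<noteq> 0 \<or> \<not> j \<le> M" for i j
      using p that by (auto simp: hv states_def PiE_def extensional_def)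
    have v0: "v (0, j) = site R j" if "j \<le> M" for j
      using p that by (auto simp: hv states_def)
    have "v = (\<lambda>(i, j)\<in>{0} \<times> {0..M}. site R j)"
      using v v0 by (auto simp: restrict_def fun_eq_iff)
    then show "p = (\<lambda>_. undefined, \<lambda>(i, j)\<in>{0} \<times> {0..M}. site R j)" using h by (auto simp: hv)
  qed (auto simp: states_def True)
  then show ?thesis using True by auto
next
  case False
  then obtain j where j: "j \<in> R \<longleftrightarrow> j \<notin> S" by blast
  then have "j \<le> M" using assms by auto
  moreover have "site R j \<noteq> site S j" using j by (auto simp: site_def)
  moreover have "\<forall>j\<in>{0..M}. v (0, j) = site R j \<and> v (0, j) = site S j"
    if "(h, v) \<in> states 0 M R S" for h v
    using that unfolding states_def by blast
  ultimately have "(h, v) \<notin> states 0 M R S" for h v by (metis atLeastAtMost_iff le0)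
  then have "states 0 M R S = {}" by (metis equals0I surj_pair)
  then show ?thesis using False by simp
qed

text \<open>The lattice is cut along the vertical edges below its top row; \<open>Q\<close> is the
  set of minus spins on the cut.\<close>

lemma states_Suc_sum:
  "(\<Sum>p\<in>states (Suc N) M R S. state_weight w (Suc N) M p) =
    (\<Sum>Q\<in>Pow {..M}. (\<Sum>p\<in>states N M R Q. state_weight w N M p) *
      row_weight (w (Suc N)) (Suc M) Plus Q S)"
proof -
  \<comment> \<open>Functions in a \<open>PiE\<close> are \<open>undefined\<close> off their domain,
    which \<open>cut\<close> restores by restricting and \<open>glue\<close> by setting the top
    edges beyond column \<open>M\<close>.\<close>
  define glue :: "nat set \<times> ((nat \<times> nat \<Rightarrow> spin) \<times> (nat \<times> nat \<Rightarrow> spin)) \<times> (nat \<Rightarrow> spin) \<Rightarrow>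
      (nat \<times> nat \<Rightarrow> spin) \<times> (nat \<times> nat \<Rightarrow> spin)" where
    "glue = (\<lambda>(Q, (h, v), g). (\<lambda>(i, j). if i = Suc N then g j else h (i, j),
      \<lambda>(i, j). if i = Suc N then (if j \<le> M then site S j else undefined) else v (i, j)))"
  define cut :: "(nat \<times> nat \<Rightarrow> spin) \<times> (nat \<times> nat \<Rightarrow> spin) \<Rightarrow>
      nat set \<times> ((nat \<times> nat \<Rightarrow> spin) \<times> (nat \<times> nat \<Rightarrow> spin)) \<times> (nat \<Rightarrow> spin)" where
    "cut = (\<lambda>(h, v). ({j. j \<le> M \<and> v (N, j) = Minus},
      (restrict h ({1..N} \<times> {0..M+1}), restrict v ({0..N} \<times> {0..M})),
      \<lambda>j\<in>{0..Suc M}. h (Suc N, j)))"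
  define D where "D = (SIGMA Q:Pow {..M}. states N M R Q \<times> row_states (Suc M) Plus)"
  define row where "row g Q = (\<Prod>j<Suc M. vertex_weight (w (Suc N)) (g j) (site S j) (g (Suc j)) (site Q j))"
    for g :: "nat \<Rightarrow> spin" and Q
  have site_cut: "site {j. j \<le> M \<and> v (N, j) = Minus} j = v (N, j)" if "j \<le> M" for v j
    using that by (cases "v (N, j)") (auto simp: site_def)
  have "(\<Sum>p\<in>states (Suc N) M R S. state_weight w (Suc N) M p) =
      (\<Sum>(Q, p, g)\<in>D. state_weight w N M p * row g Q)"
  proof (rule sum.reindex_bij_witness[of _ glue cut])
    fix p assume p: "p \<in> states (Suc N) M R S"
    obtain h v where hv: "p = (h, v)" by fastforce
    have h: "h (i, j) = undefined" if "i \<notin> {1..Suc N} \<or> j \<notin> {0..M+1}" for i j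
      using p that by (auto simp: hv states_def PiE_def extensional_def)
    have v: "v (i, j) = undefined" if "i \<notin> {0..Suc N} \<or> j \<notin> {0..M}" for i j
      using p that by (auto simp: hv states_def PiE_def extensional_def)
    have b: "h (i, 0) = Plus" "h (i, M + 1) = Plus" if "i \<in> {1..Suc N}" for i
      using p that by (auto simp: hv states_def)
    have t: "v (0, j) = site R j" "v (Suc N, j) = site S j" if "j \<le> M" for j
      using p that by (auto simp: hv states_def)
    show "glue (cut p) = p"
      using h v t by (auto simp: hv glue_def cut_def fun_eq_iff)
    show "cut p \<in> D"
      using b t site_cut by (auto simp: hv cut_def D_def states_def row_states_def)
    show "(case cut p of (Q, p, g) \<Rightarrow> state_weight w N M p * row g Q) = state_weight w (Suc N) M p"
    proof -
      have "state_weight w N M (restrict h ({1..N} \<times> {0..M+1}), restrict v ({0..N} \<times> {0..M})) =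
          state_weight w N M (h, v)"
        unfolding state_weight_def prod.case by (intro prod.cong refl) auto
      moreover have "row (\<lambda>j\<in>{0..Suc M}. h (Suc N, j)) {j. j \<le> M \<and> v (N, j) = Minus} =
          (\<Prod>j=0..M. vertex_weight (w (Suc N)) (h (Suc N, j)) (v (Suc N, j)) (h (Suc N, j + 1)) (v (N, j)))"
        unfolding row_def using site_cut t by (intro prod.cong) auto
      ultimately show ?thesis by (simp add: hv cut_def) (simp add: state_weight_def)
    qed
  next
    fix q assume q: "q \<in> D"
    obtain Q h v g where Q: "q = (Q, (h, v), g)" by (metis surj_pair)
    have QM: "Q \<subseteq> {..M}" using q by (auto simp: Q D_def)
    have h: "h (i, j) = undefined" if "i \<notin> {1..N} \<or> j \<notin> {0..M+1}" for i j
      using q that by (auto simp: Q D_def states_def PiE_def extensional_def)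
    have v: "v (i, j) = undefined" if "i \<notin> {0..N} \<or> j \<notin> {0..M}" for i j
      using q that by (auto simp: Q D_def states_def PiE_def extensional_def)
    have g: "g j = undefined" if "j \<notin> {0..Suc M}" for j
      using q that by (auto simp: Q D_def row_states_def PiE_def extensional_def)
    have b: "h (i, 0) = Plus" "h (i, M + 1) = Plus" if "i \<in> {1..N}" for i
      using q that by (auto simp: Q D_def states_def)
    have bg: "g 0 = Plus" "g (Suc M) = Plus" using q by (auto simp: Q D_def row_states_def)
    have t: "v (0, j) = site R j" "v (N, j) = site Q j" if "j \<le> M" for j
      using q that by (auto simp: Q D_def states_def)
    have "{j. j \<le> M \<and> v (N, j) = Minus} = Q"
      using t QM by (auto simp: site_def split: if_splits)
    then show "cut (glue q) = q"
      using h v g by (auto simp: Q glue_def cut_def fun_eq_iff restrict_def)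
    show "glue q \<in> states (Suc N) M R S"
      using h v g b bg t by (auto simp: Q glue_def states_def PiE_def extensional_def)
  qed
  also have "\<dots> = (\<Sum>Q\<in>Pow {..M}. \<Sum>p\<in>states N M R Q. \<Sum>g\<in>row_states (Suc M) Plus.
      state_weight w N M p * row g Q)"
    unfolding D_def
    by (subst sum.Sigma[symmetric]) (simp_all add: finite_states finite_row_states sum.cartesian_product)
  also have "\<dots> = (\<Sum>Q\<in>Pow {..M}. (\<Sum>p\<in>states N M R Q. state_weight w N M p) *
      row_weight (w (Suc N)) (Suc M) Plus Q S)"
    unfolding row_weight_eq_sum[symmetric] row_def sum_product ..
  finally show ?thesis .
qed

fun transfer_product :: "(nat \<Rightarrow> vertex_weights) \<Rightarrow> nat \<Rightarrow> nat \<Rightarrow> nat set \<Rightarrow> nat set \<Rightarrow> complex" where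
  "transfer_product w 0 M R S = basis_fun R S"
| "transfer_product w (Suc N) M R S =
    (\<Sum>Q\<in>Pow {..M}. transfer_product w N M R Q * row_weight (w (Suc N)) (Suc M) Plus Q S)"

lemma sum_states_eq_transfer:
  assumes "R \<subseteq> {..M}" "S \<subseteq> {..M}"
  shows "(\<Sum>p\<in>states N M R S. state_weight w N M p) = transfer_product w N M R S"
  using assms(2)
proof (induction N arbitrary: S)
  case 0
  then show ?case using assms(1) by (simp add: states_0 state_weight_def basis_fun_def)
next
  case (Suc N)
  then show ?case by (simp add: states_Suc_sum)
qed

lemma partition_function_eq_transfer:
  assumes "set la \<union> set mu \<subseteq> {..M}"
  shows "partition_function w N M la mu = transfer_product w N M (set la) (set mu)"
  using sum_states_eq_transfer[of "set la" M "set mu" w N] assms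
  by (simp add: partition_function_def lattice_states_eq state_weight_def)

subsection \<open>Matching the two sides\<close>

text \<open>Each weight is divided by \<open>a1\<close> or \<open>b1\<close> according to the bottom
  spin alone. The factor removed from a row then depends only on the number of particles below
  it.\<close>

definition normalize_weights :: "vertex_weights \<Rightarrow> vertex_weights" where
  "normalize_weights w = \<lparr>a1 = 1, a2 = a2 w / b1 w, b1 = 1, b2 = b2 w / a1 w,
     c1 = c1 w / b1 w, c2 = c2 w / a1 w\<rparr>"

lemma vertex_weight_normalize:
  assumes "a1 w \<noteq> 0" "b1 w \<noteq> 0"
  shows "vertex_weight w l t r b =
    (if b = Minus then b1 w else a1 w) * vertex_weight (normalize_weights w) l t r b"
  using assms by (cases l; cases t; cases r; cases b) (simp_all add: normalize_weights_def)

lemma card_Int_lessThan_Suc: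
  "card (R \<inter> {..<Suc n}) = card (R \<inter> {..<n}) + (if n \<in> R then 1 else 0)"
  by (simp add: lessThan_Suc)

lemma row_weight_normalize:
  assumes "a1 w \<noteq> 0" "b1 w \<noteq> 0"
  shows "row_weight w n r R S =
    a1 w ^ n * (b1 w / a1 w) ^ card (R \<inter> {..<n}) * row_weight (normalize_weights w) n r R S"
proof (induction n arbitrary: r)
  case (Suc n)
  have "a1 w ^ Suc n * (b1 w / a1 w) ^ card (R \<inter> {..<Suc n}) =
      (if site R n = Minus then b1 w else a1 w) * (a1 w ^ n * (b1 w / a1 w) ^ card (R \<inter> {..<n}))"
    using assms unfolding card_Int_lessThan_Suc by (simp add: site_def)
  then show ?case
    unfolding row_weight.simps Suc vertex_weight_normalize[OF assms]
    by (simp only:) (simp add: distrib_left mult_ac)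
qed simp

lemma vertex_weight_conservation:
  assumes "vertex_weight w l t r b \<noteq> 0"
  shows "of_bool (l = Minus) + of_bool (t = Minus) = (of_bool (r = Minus) + of_bool (b = Minus) :: nat)"
  using assms by (cases l; cases t; cases r; cases b) simp_all

lemma row_weight_conservation:
  assumes "row_weight w n r R S \<noteq> 0"
  shows "card (S \<inter> {..<n}) = card (R \<inter> {..<n}) + of_bool (r = Minus)"
  using assms
proof (induction n arbitrary: r)
  case 0
  then show ?case by (auto split: if_splits)
next
  case (Suc n)
  then obtain l where l: "vertex_weight w l (site S n) r (site R n) \<noteq> 0" "row_weight w n l R S \<noteq> 0"
    by (metis add.right_neutral mult_zero_left mult_zero_right row_weight.simps(2))
  show ?case
    using Suc.IH[OF l(2)] vertex_weight_conservation[OF l(1)] unfolding card_Int_lessThan_Suc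
    by (cases l; cases r) (simp_all add: site_def split: if_splits)
qed

lemma row_weight_conservation_Plus:
  assumes "row_weight w (Suc M) Plus R S \<noteq> 0" "R \<subseteq> {..M}" "S \<subseteq> {..M}"
  shows "card S = card R"
proof -
  have "R \<inter> {..<Suc M} = R" "S \<inter> {..<Suc M} = S" using assms by auto
  then show ?thesis using row_weight_conservation[OF assms(1)] by simp
qed

lemma transfer_conservation:
  assumes "transfer_product w N M R S \<noteq> 0" "R \<subseteq> {..M}" "S \<subseteq> {..M}"
  shows "card S = card R"
  using assms(1,3)
proof (induction N arbitrary: S)
  case 0
  then show ?case by (simp add: basis_fun_def split: if_splits)
next
  case (Suc N)
  then obtain Q where "Q \<in> Pow {..M}" "transfer_product w N M R Q * row_weight (w (Suc N)) (Suc M) Plus Q S \<noteq> 0"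
    by (metis (no_types, lifting) sum.neutral transfer_product.simps(2))
  then show ?case using Suc row_weight_conservation_Plus[of "w (Suc N)" M Q S] by auto
qed

text \<open>Each row gives a power of \<open>B\<close> with the number of its own incoming
  particles. Conservation of particles makes all these exponents equal to that of the bottom
  row.\<close>

lemma transfer_normalize:
  assumes "\<And>i. i \<ge> 1 \<Longrightarrow> a1 (w i) \<noteq> 0 \<and> b1 (w i) \<noteq> 0" "R \<subseteq> {..M}" "S \<subseteq> {..M}"
  shows "transfer_product w N M R S = (\<Prod>i=1..N. a1 (w i) ^ (M + 1) * (b1 (w i) / a1 (w i)) ^ card R) *
    transfer_product (\<lambda>i. normalize_weights (w i)) N M R S"
  using assms(3)
proof (induction N arbitrary: S)
  case (Suc N)
  let ?n = "\<lambda>i. normalize_weights (w i)"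
  let ?c = "\<lambda>i. a1 (w i) ^ (M + 1) * (b1 (w i) / a1 (w i)) ^ card R"
  have "transfer_product w N M R Q * row_weight (w (Suc N)) (Suc M) Plus Q S =
      (\<Prod>i=1..Suc N. ?c i) * (transfer_product ?n N M R Q * row_weight (?n (Suc N)) (Suc M) Plus Q S)"
    if "Q \<in> Pow {..M}" for Q
  proof (cases "transfer_product ?n N M R Q = 0")
    case True
    then show ?thesis using Suc.IH[of Q] that by simp
  next
    case False
    then have "card Q = card R" using that assms(2) by (intro transfer_conservation[OF False]) auto
    moreover have "Q \<inter> {..<Suc M} = Q" using that by auto
    ultimately have "row_weight (w (Suc N)) (Suc M) Plus Q S =
        ?c (Suc N) * row_weight (?n (Suc N)) (Suc M) Plus Q S"
      using row_weight_normalize[of "w (Suc N)" "Suc M" Plus Q S] assms(1)[of "Suc N"] by simp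
    then show ?thesis using Suc.IH[of Q] that by (simp add: mult_ac)
  qed
  then show ?case by (simp only: transfer_product.simps sum_distrib_left) simp
qed simp

lemma transfer_cong:
  assumes "\<And>i. i \<ge> 1 \<Longrightarrow> w i = w' i"
  shows "transfer_product w N M R S = transfer_product w' N M R S"
  by (induction N arbitrary: S) (simp_all add: assms)

text \<open>The prefactor is exactly the one removed by normalization, and it is nonzero. After
  cancelling it, lists, Fock space, \<open>A\<close> and \<open>B\<close> have disappeared from the
  identity.\<close>

lemma Z_matches_fock_iff:
  assumes nz: "\<And>i. i \<ge> 1 \<Longrightarrow> a1 (w i) \<noteq> 0 \<and> b1 (w i) \<noteq> 0"
    and AB: "\<And>i. i \<ge> 1 \<Longrightarrow> A i = a1 (w i) \<and> B i = b1 (w i) / a1 (w i)"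
  shows "Z_matches_fock w A B s \<longleftrightarrow>
    (\<forall>N\<ge>1. \<forall>M R S. R \<subseteq> {..M} \<and> S \<subseteq> {..M} \<longrightarrow>
      transfer_product (\<lambda>i. normalize_weights (w i)) N M R S =
        wedge_image M (fps_exp 1 oo hamiltonian_series s N) R S)"
proof -
  have eq: "partition_function w N M la mu =
        (\<Prod>i=1..N. A i ^ (M + 1) * B i ^ length la) * matrix_coeff mu (fock_exp (H_plus s N)) la \<longleftrightarrow>
      transfer_product (\<lambda>i. normalize_weights (w i)) N M (set la) (set mu) =
        wedge_image M (fps_exp 1 oo hamiltonian_series s N) (set la) (set mu)"
    if "strict_partition la" "strict_partition mu" "set la \<subseteq> {..M}" "set mu \<subseteq> {..M}" for la mu N M
  proof -
    have "distinct la" using that(1) unfolding strict_partition_def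
      by (simp add: sorted_wrt_iff_nth_less distinct_conv_nth) (metis less_irrefl linorder_neqE_nat)
    then have "length la = card (set la)" by (simp add: distinct_card)
    define c where "c = (\<Prod>i=1..N. a1 (w i) ^ (M + 1) * (b1 (w i) / a1 (w i)) ^ card (set la))"
    have "(\<Prod>i=1..N. A i ^ (M + 1) * B i ^ length la) = c"
      unfolding c_def using AB \<open>length la = card (set la)\<close> by (intro prod.cong) auto
    moreover have "c \<noteq> 0"
      unfolding c_def using nz by (simp add: prod_zero_iff)
    moreover have "partition_function w N M la mu =
        c * transfer_product (\<lambda>i. normalize_weights (w i)) N M (set la) (set mu)"
      unfolding c_def using that partition_function_eq_transfer[of la mu M w N]
        transfer_normalize[of w "set la" M "set mu" N, OF nz] by simp
    moreover have "matrix_coeff mu (fock_exp (H_plus s N)) la =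
        wedge_image M (fps_exp 1 oo hamiltonian_series s N) (set la) (set mu)"
      using that by (intro matrix_coeff_eq_wedge_image) auto
    ultimately show ?thesis by simp
  qed
  show ?thesis
  proof
    assume m: "Z_matches_fock w A B s"
    show "\<forall>N\<ge>1. \<forall>M R S. R \<subseteq> {..M} \<and> S \<subseteq> {..M} \<longrightarrow>
      transfer_product (\<lambda>i. normalize_weights (w i)) N M R S =
        wedge_image M (fps_exp 1 oo hamiltonian_series s N) R S"
    proof (intro allI impI, elim conjE)
      fix N M R S assume N: "N \<ge> (1 :: nat)" and R: "R \<subseteq> {..M :: nat}" and S: "S \<subseteq> {..M}"
      define la where "la = rev (sorted_list_of_set R)"
      define mu where "mu = rev (sorted_list_of_set S)"
      have la: "strict_partition la" "set la = R" and mu: "strict_partition mu" "set mu = S"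
        using R S finite_of_Pow[of _ M] by (simp_all add: la_def mu_def strict_partition_sorted_list)
      have "partition_function w N M la mu =
        (\<Prod>i=1..N. A i ^ (M + 1) * B i ^ length la) * matrix_coeff mu (fock_exp (H_plus s N)) la"
        using m N R S la mu unfolding Z_matches_fock_def by blast
      then show "transfer_product (\<lambda>i. normalize_weights (w i)) N M R S =
          wedge_image M (fps_exp 1 oo hamiltonian_series s N) R S"
        using eq[of la mu M N] la mu R S by simp
    qed
  next
    assume m: "\<forall>N\<ge>1. \<forall>M R S. R \<subseteq> {..M} \<and> S \<subseteq> {..M} \<longrightarrow>
      transfer_product (\<lambda>i. normalize_weights (w i)) N M R S =
        wedge_image M (fps_exp 1 oo hamiltonian_series s N) R S"
    show "Z_matches_fock w A B s"
      unfolding Z_matches_fock_def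
    proof (intro allI impI, elim conjE)
      fix la mu :: "nat list" and N M :: nat
      assume *: "strict_partition la" "strict_partition mu" "N \<ge> 1" "\<forall>p\<in>set la \<union> set mu. p \<le> M"
      then have "set la \<subseteq> {..M}" "set mu \<subseteq> {..M}" by auto
      then show "partition_function w N M la mu =
        (\<Prod>i=1..N. A i ^ (M + 1) * B i ^ length la) * matrix_coeff mu (fock_exp (H_plus s N)) la"
        using eq[of la mu M N] * m by blast
    qed
  qed
qed

lemma wedge_image_1:
  assumes "R \<subseteq> {..M}"
  shows "wedge_image M 1 R = basis_fun R"
proof (rule wedge_image_unique[symmetric])
  fix m R assume "m \<le> M" "\<forall>j\<in>R. j < m"
  then have "basis_fun (insert m R) = create M m (basis_fun R)"
    using create_basis_fun[of m R M] by auto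
  also have "\<dots> = vertex_op M 1 m (basis_fun R)"
    by (auto simp: vertex_op_def fps_one_nth if_distrib[of "\<lambda>c. c * _"] cong: if_cong)
  finally show "basis_fun (insert m R) = vertex_op M 1 m (basis_fun R)" .
qed (use assms in auto)

lemma transfer_free_fermionic:
  assumes "R \<subseteq> {..M}" "S \<subseteq> {..M}"
  shows "transfer_product (\<lambda>i. free_fermionic (x i) (y i)) N M R S =
    wedge_image M (\<Prod>i=1..N. row_series (x i) (y i)) R S"
  using assms(2)
proof (induction N arbitrary: S)
  case 0
  then show ?case using assms(1) by (simp add: wedge_image_1)
next
  case (Suc N)
  have "transfer_product (\<lambda>i. free_fermionic (x i) (y i)) (Suc N) M R S =
      (\<Sum>Q\<in>Pow {..M}. wedge_image M (\<Prod>i=1..N. row_series (x i) (y i)) R Q *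
        wedge_image M (row_series (x (Suc N)) (y (Suc N))) Q S)"
    using Suc by (simp add: free_fermionic_row del: row_weight.simps)
  also have "\<dots> = wedge_image M ((\<Prod>i=1..N. row_series (x i) (y i)) * row_series (x (Suc N)) (y (Suc N))) R S"
    by (rule wedge_image_compose[OF assms(1)])
  finally show ?case by (simp add: mult.commute del: transfer_product.simps)
qed

lemma wedge_image_one_particle:
  assumes "m \<le> M"
  shows "wedge_image M h {m} {0} = fps_nth h m"
proof -
  have "create M n (basis_fun {}) = basis_fun {n}" for n
    by (rule create_basis_fun) auto
  then have "wedge_image M h {m} {0} = (\<Sum>k\<le>m. fps_nth h k * basis_fun {m - k} {0})"
    using wedge_image_insert[of "{}" m M h] by (simp add: wedge_image_empty vertex_op_def)
  also have "\<dots> = (\<Sum>k\<le>m. if k = m then fps_nth h k else 0)"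
    by (intro sum.cong) (auto simp: basis_fun_def)
  finally show ?thesis by simp
qed

text \<open>A Toeplitz minor: both particles move by one site, minus the crossing in which one stays
  and the other jumps by two.\<close>

lemma wedge_image_two_particles:
  "wedge_image 2 h {1, 2} {0, 1} = fps_nth h 1 * fps_nth h 1 - fps_nth h 0 * fps_nth h 2"
proof -
  have "{j. (j = 0 \<or> j = 1) \<and> 0 < j \<and> j \<le> 2} = {1 :: nat}" by auto
  then have "order_sign 2 0 {0, 1} = -1" by (simp add: order_sign_def)
  moreover have "order_sign 2 1 {0, 1} = 1" "order_sign 2 m {m} = 1" for m
    by (rule order_sign_max; auto)+
  ultimately have sgn: "order_sign 2 0 {0, Suc 0} = -1" "order_sign 2 (Suc 0) {0, Suc 0} = 1"
    "order_sign 2 m {m} = 1" for m by simp_all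
  have "wedge_image 2 h {1, 2} = vertex_op 2 h 2 (vertex_op 2 h 1 (basis_fun {}))"
    using wedge_image_insert[of "{1}" 2 2 h] wedge_image_insert[of "{}" 1 2 h]
    by (simp add: wedge_image_empty insert_commute)
  moreover have "{0, Suc 0} - {0} = {Suc 0}" "{0, Suc 0} - {Suc 0} = {0}" by auto
  ultimately show ?thesis
    using sgn by (simp add: vertex_op_def create_def basis_fun_def numeral_2_eq_2[symmetric])
      (simp add: numeral_2_eq_2)
qed

text \<open>Each of these boundaries admits a single assignment of horizontal spins. In the last one
  the particle from site \<open>2\<close> reaches the occupied site \<open>1\<close>, which gives
  the vertex \<open>a2\<close>.\<close>

lemma row_weight_examples:
  assumes "a1 w = 1" "b1 w = 1"
  shows "row_weight w (Suc 2) Plus {0} {0} = 1"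
    "row_weight w (Suc 2) Plus {1} {0} = c1 w * c2 w"
    "row_weight w (Suc 2) Plus {2} {0} = c1 w * b2 w * c2 w"
    "row_weight w (Suc 2) Plus {1, 2} {0, 1} = c1 w * a2 w * c2 w"
  using assms by (simp_all add: numeral_2_eq_2 site_def)

lemma hamiltonian_series_nth_0: "fps_nth (hamiltonian_series s N) 0 = 0"
  by (simp add: hamiltonian_series_def)

lemma fps_exp_compose_0: "fps_exp 1 oo (0 :: complex fps) = 1"
  by (rule fps_exp_compose_unique) simp_all

lemma hamiltonian_series_0: "hamiltonian_series s 0 = 0"
  by (rule fps_ext) (simp add: hamiltonian_series_def)

lemma exp_hamiltonian_series:
  assumes "\<And>k j. k \<ge> 1 \<Longrightarrow> j \<ge> 1 \<Longrightarrow> s k j = 1 / of_nat k * (x j ^ k + (-1) ^ (k - 1) * y j ^ k)"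
  shows "fps_exp 1 oo hamiltonian_series s N = (\<Prod>i=1..N. row_series (x i) (y i))"
proof (induction N)
  case 0
  then show ?case by (simp add: hamiltonian_series_0 fps_exp_compose_0)
next
  case (Suc N)
  have "hamiltonian_series s (Suc N) =
      hamiltonian_series s N + supersymmetric_power_series (x (Suc N)) (y (Suc N))"
  proof (rule fps_ext)
    fix k show "fps_nth (hamiltonian_series s (Suc N)) k =
        fps_nth (hamiltonian_series s N + supersymmetric_power_series (x (Suc N)) (y (Suc N))) k"
      using assms[of k "Suc N"]
      by (cases "k = 0") (simp_all add: hamiltonian_series_def supersymmetric_power_series_def)
  qed
  then show ?case
    using Suc by (simp add: fps_exp_compose_add hamiltonian_series_nth_0 exp_supersymmetric
        supersymmetric_power_series_def[THEN arg_cong, of "\<lambda>f. fps_nth f 0"] mult.commute)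
qed

lemma Z_matches_fock_free_fermionic:
  assumes nz: "\<forall>i\<ge>1. A i \<noteq> 0 \<and> B i \<noteq> 0"
  shows "Z_matches_fock
      (\<lambda>i. \<lparr>a1 = A i, a2 = y i * A i * B i, b1 = A i * B i, b2 = x i * A i,
             c1 = (x i + y i) * A i * B i, c2 = A i\<rparr>) A B s \<longleftrightarrow>
    (\<forall>k\<ge>1. \<forall>j\<ge>1. s k j = 1 / of_nat k * (x j ^ k + (-1) ^ (k - 1) * y j ^ k))"
    (is "Z_matches_fock ?w A B s \<longleftrightarrow> ?formula s")
proof -
  define P where "P N = (\<Prod>i=1..N. row_series (x i) (y i))" for N
  have "normalize_weights (?w i) = free_fermionic (x i) (y i)" if "i \<ge> 1" for i
    using nz that by (simp add: normalize_weights_def free_fermionic_def)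
  then have "transfer_product (\<lambda>i. normalize_weights (?w i)) N M R S = wedge_image M (P N) R S"
    if "R \<subseteq> {..M}" "S \<subseteq> {..M}" for N M R S
    using that transfer_cong[of "\<lambda>i. normalize_weights (?w i)" "\<lambda>i. free_fermionic (x i) (y i)"]
    by (simp add: P_def transfer_free_fermionic)
  moreover have "Z_matches_fock ?w A B s \<longleftrightarrow>
    (\<forall>N\<ge>1. \<forall>M R S. R \<subseteq> {..M} \<and> S \<subseteq> {..M} \<longrightarrow>
      transfer_product (\<lambda>i. normalize_weights (?w i)) N M R S =
        wedge_image M (fps_exp 1 oo hamiltonian_series s N) R S)"
    using nz by (intro Z_matches_fock_iff) auto
  ultimately have iff: "Z_matches_fock ?w A B s \<longleftrightarrow>
    (\<forall>N\<ge>1. \<forall>M R S. R \<subseteq> {..M} \<and> S \<subseteq> {..M} \<longrightarrow>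
      wedge_image M (P N) R S = wedge_image M (fps_exp 1 oo hamiltonian_series s N) R S)"
    by auto
  \<comment> \<open>The expected solution serves as reference: any other solution has the same
    exponential for every \<open>N\<close>, hence the same logarithm.\<close>
  define s0 where "s0 k j = 1 / of_nat k * (x j ^ k + (-1) ^ (k - 1) * y j ^ k)" for k j
  have s0: "fps_exp 1 oo hamiltonian_series s0 N = P N" for N
    unfolding P_def by (rule exp_hamiltonian_series) (simp add: s0_def)
  show ?thesis
  proof
    assume "Z_matches_fock ?w A B s"
    then have eq: "wedge_image M (P N) R S = wedge_image M (fps_exp 1 oo hamiltonian_series s N) R S"
      if "N \<ge> 1" "R \<subseteq> {..M}" "S \<subseteq> {..M}" for N M R S
      using iff that by blast
    have "fps_exp 1 oo hamiltonian_series s N = P N" if "N \<ge> 1" for N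
    proof (rule fps_ext)
      fix m show "fps_nth (fps_exp 1 oo hamiltonian_series s N) m = fps_nth (P N) m"
        using eq[OF that, of "{m}" m "{0}"] by (simp add: wedge_image_one_particle)
    qed
    then have "hamiltonian_series s N = hamiltonian_series s0 N" if "N \<ge> 1" for N
      using that
      by (metis fps_exp_compose_inject hamiltonian_series_nth_0 s0)
    \<comment> \<open>\<open>N = 0\<close> is added so that \<open>s k 1\<close> is also a
      difference of two consecutive sums.\<close>
    then have hs: "hamiltonian_series s N = hamiltonian_series s0 N" for N
      by (cases "N = 0") (simp_all add: hamiltonian_series_0)
    show "?formula s"
    proof (intro allI impI)
      fix k j :: nat assume k: "k \<ge> 1" and j: "j \<ge> 1"
      obtain n where n: "j = Suc n" using j by (cases j) auto
      have "fps_nth (hamiltonian_series s' (Suc n)) k = fps_nth (hamiltonian_series s' n) k + s' k j" for s'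
        using k by (simp add: hamiltonian_series_def n)
      then have "s k j = s0 k j" using hs[of "Suc n"] hs[of n] by (metis add_left_imp_eq)
      then show "s k j = 1 / of_nat k * (x j ^ k + (-1) ^ (k - 1) * y j ^ k)" by (simp add: s0_def)
    qed
  next
    assume "?formula s"
    then have "fps_exp 1 oo hamiltonian_series s N = P N" for N
      unfolding P_def by (intro exp_hamiltonian_series) blast
    then show "Z_matches_fock ?w A B s" unfolding iff by simp
  qed
qed

text \<open>Row \<open>N + 1\<close> is recovered from the identities for \<open>N\<close> and \<open>N + 1\<close> rows, because the operators
  \<open>wedge_image M h\<close> with \<open>h 0 = 1\<close> are invertible.\<close>

lemma row_weight_eq_wedge_image:
  assumes hyp: "\<And>N R S. R \<subseteq> {..M} \<Longrightarrow> S \<subseteq> {..M} \<Longrightarrow> transfer_product w N M R S = wedge_image M (h N) R S"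
    and h: "\<And>N. fps_nth (h N) 0 = 1" and R: "R \<subseteq> {..M}" and S: "S \<subseteq> {..M}"
  shows "row_weight (w (Suc N)) (Suc M) Plus R S = wedge_image M (inverse (h N) * h (Suc N)) R S"
proof -
  let ?t = "\<lambda>Q. row_weight (w (Suc N)) (Suc M) Plus Q S"
  have inv: "inverse (h N) * h N = 1" using h[of N] by (simp add: inverse_mult_eq_1)
  \<comment> \<open>The identity matrix is inserted and then factored as the inverse of the first
    \<open>N\<close> rows times these rows.\<close>
  have "?t R = (\<Sum>Q\<in>Pow {..M}. if Q = R then ?t Q else 0)" using R by simp
  also have "\<dots> = (\<Sum>Q\<in>Pow {..M}. wedge_image M (inverse (h N) * h N) R Q * ?t Q)"
    unfolding inv wedge_image_1[OF R] by (intro sum.cong) (auto simp: basis_fun_def)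
  also have "\<dots> = (\<Sum>Q\<in>Pow {..M}. \<Sum>P\<in>Pow {..M}.
      wedge_image M (inverse (h N)) R P * (wedge_image M (h N) P Q * ?t Q))"
    unfolding wedge_image_compose[OF R, symmetric] sum_distrib_right by (simp only: mult.assoc)
  also have "\<dots> = (\<Sum>P\<in>Pow {..M}. wedge_image M (inverse (h N)) R P *
      (\<Sum>Q\<in>Pow {..M}. wedge_image M (h N) P Q * ?t Q))"
    unfolding sum_distrib_left by (rule sum.swap)
  also have "\<dots> = (\<Sum>P\<in>Pow {..M}. wedge_image M (inverse (h N)) R P * wedge_image M (h (Suc N)) P S)"
  proof (intro sum.cong refl)
    fix P assume P: "P \<in> Pow {..M}"
    have "(\<Sum>Q\<in>Pow {..M}. wedge_image M (h N) P Q * ?t Q) = (\<Sum>Q\<in>Pow {..M}. transfer_product w N M P Q * ?t Q)"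
      using P by (intro sum.cong refl) (subst hyp, auto)
    also have "\<dots> = wedge_image M (h (Suc N)) P S"
      using hyp[of P S "Suc N"] P S by (simp only: transfer_product.simps) simp
    finally show "wedge_image M (inverse (h N)) R P * (\<Sum>Q\<in>Pow {..M}. wedge_image M (h N) P Q * ?t Q) =
      wedge_image M (inverse (h N)) R P * wedge_image M (h (Suc N)) P S" by simp
  qed
  finally show ?thesis by (simp add: wedge_image_compose R)
qed

text \<open>The columns \<open>0\<close>, \<open>1\<close>, \<open>2\<close> suffice: one particle
  determines the coefficients of the row series up to degree two, and the minor they form must equal
  the entry containing \<open>a2\<close>.\<close>

lemma Z_matches_fock_imp_free_fermionic:
  assumes nz: "\<And>i. i \<ge> 1 \<Longrightarrow> a1 (w i) \<noteq> 0 \<and> b1 (w i) \<noteq> 0 \<and> c1 (w i) \<noteq> 0 \<and> c2 (w i) \<noteq> 0"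
    and m: "Z_matches_fock w (\<lambda>i. a1 (w i)) (\<lambda>i. b1 (w i) / a1 (w i)) s" and i: "i \<ge> 1"
  shows "a1 (w i) * a2 (w i) + b1 (w i) * b2 (w i) = c1 (w i) * c2 (w i)"
proof -
  obtain n where n: "i = Suc n" using i by (cases i) auto
  let ?h = "\<lambda>N. fps_exp 1 oo hamiltonian_series s N"
  have "Z_matches_fock w (\<lambda>i. a1 (w i)) (\<lambda>i. b1 (w i) / a1 (w i)) s \<longleftrightarrow>
    (\<forall>N\<ge>1. \<forall>M R S. R \<subseteq> {..M} \<and> S \<subseteq> {..M} \<longrightarrow>
      transfer_product (\<lambda>i. normalize_weights (w i)) N M R S = wedge_image M (?h N) R S)"
    using nz by (intro Z_matches_fock_iff) auto
  \<comment> \<open>The identity is supplied by hand for \<open>N = 0\<close>, which isolating the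
    first row requires.\<close>
  then have "transfer_product (\<lambda>i. normalize_weights (w i)) N 2 R S = wedge_image 2 (?h N) R S"
    if "R \<subseteq> {..2}" "S \<subseteq> {..2}" for N R S
    using m that by (cases "N = 0") (auto simp: hamiltonian_series_0 fps_exp_compose_0 wedge_image_1)
  then have row: "row_weight (normalize_weights (w i)) (Suc 2) Plus R S =
      wedge_image 2 (inverse (?h n) * ?h (Suc n)) R S"
    if "R \<subseteq> {..2}" "S \<subseteq> {..2}" for R S
    unfolding n using that by (intro row_weight_eq_wedge_image) auto
  define g where "g = inverse (?h n) * ?h (Suc n)"
  define u where "u = normalize_weights (w i)"
  have u: "a1 u = 1" "b1 u = 1" by (simp_all add: u_def normalize_weights_def)
  have "fps_nth g 0 = 1" "fps_nth g 1 = c1 u * c2 u" "fps_nth g 2 = c1 u * b2 u * c2 u"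
    using row[of "{0}" "{0}"] row[of "{1}" "{0}"] row[of "{2}" "{0}"]
    unfolding g_def[symmetric] u_def[symmetric] row_weight_examples[OF u]
    by (simp_all add: wedge_image_one_particle)
  moreover have "c1 u * a2 u * c2 u = fps_nth g 1 * fps_nth g 1 - fps_nth g 0 * fps_nth g 2"
    using row[of "{1, 2}" "{0, 1}"]
    unfolding g_def[symmetric] u_def[symmetric] row_weight_examples[OF u] wedge_image_two_particles
    by simp
  ultimately have "c1 u * c2 u * (a2 u + b2 u) = c1 u * c2 u * (c1 u * c2 u)"
    by (simp add: algebra_simps)
  \<comment> \<open>All entries used with a moving particle carry \<open>c1 * c2\<close>, so the
    condition emerges only after dividing by it.\<close>
  moreover have "c1 u \<noteq> 0" "c2 u \<noteq> 0" using nz[OF i] by (simp_all add: u_def normalize_weights_def)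
  ultimately have "a2 u + b2 u = c1 u * c2 u" by simp
  then show ?thesis using nz[OF i] by (simp add: u_def normalize_weights_def field_simps)
qed

theorem theorem4p1:
  "(\<forall>(x :: nat \<Rightarrow> complex) (y :: nat \<Rightarrow> complex) (A :: nat \<Rightarrow> complex) (B :: nat \<Rightarrow> complex)
      (s :: nat \<Rightarrow> nat \<Rightarrow> complex).
      (\<forall>i\<ge>1. A i \<noteq> 0 \<and> B i \<noteq> 0) \<longrightarrow>
      (Z_matches_fock
         (\<lambda>i. \<lparr>a1 = A i, a2 = y i * A i * B i, b1 = A i * B i, b2 = x i * A i,
                c1 = (x i + y i) * A i * B i, c2 = A i\<rparr>) A B s
       \<longleftrightarrow> (\<forall>k\<ge>1. \<forall>j\<ge>1. s k j = 1 / of_nat k * (x j ^ k + (-1) ^ (k - 1) * y j ^ k))))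
   \<and>
   (\<forall>w :: nat \<Rightarrow> vertex_weights.
      (\<forall>i\<ge>1. a1 (w i) \<noteq> 0 \<and> a2 (w i) \<noteq> 0 \<and> b1 (w i) \<noteq> 0 \<and> b2 (w i) \<noteq> 0 \<and>
              c1 (w i) \<noteq> 0 \<and> c2 (w i) \<noteq> 0) \<and>
      (\<exists>i\<ge>1. a1 (w i) * a2 (w i) + b1 (w i) * b2 (w i) \<noteq> c1 (w i) * c2 (w i)) \<longrightarrow>
      \<not> (\<exists>s :: nat \<Rightarrow> nat \<Rightarrow> complex.
            Z_matches_fock w (\<lambda>i. a1 (w i)) (\<lambda>i. b1 (w i) / a1 (w i)) s))"
proof (intro conjI allI impI)
  fix x y A B :: "nat \<Rightarrow> complex" and s :: "nat \<Rightarrow> nat \<Rightarrow> complex"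
  assume "\<forall>i\<ge>1. A i \<noteq> 0 \<and> B i \<noteq> 0"
  then show "Z_matches_fock
      (\<lambda>i. \<lparr>a1 = A i, a2 = y i * A i * B i, b1 = A i * B i, b2 = x i * A i,
             c1 = (x i + y i) * A i * B i, c2 = A i\<rparr>) A B s \<longleftrightarrow>
    (\<forall>k\<ge>1. \<forall>j\<ge>1. s k j = 1 / of_nat k * (x j ^ k + (-1) ^ (k - 1) * y j ^ k))"
    by (rule Z_matches_fock_free_fermionic)
next
  fix w :: "nat \<Rightarrow> vertex_weights"
  assume w: "(\<forall>i\<ge>1. a1 (w i) \<noteq> 0 \<and> a2 (w i) \<noteq> 0 \<and> b1 (w i) \<noteq> 0 \<and> b2 (w i) \<noteq> 0 \<and>
              c1 (w i) \<noteq> 0 \<and> c2 (w i) \<noteq> 0) \<and>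
      (\<exists>i\<ge>1. a1 (w i) * a2 (w i) + b1 (w i) * b2 (w i) \<noteq> c1 (w i) * c2 (w i))"
  then show "\<not> (\<exists>s. Z_matches_fock w (\<lambda>i. a1 (w i)) (\<lambda>i. b1 (w i) / a1 (w i)) s)"
    using Z_matches_fock_imp_free_fermionic[of w] by blast
qed

end
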